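(* Let $\mathrm{SP}=\mathrm{Ope}(\mathcal{G},\mathcal{R})$ be the binary quadratic operad with two symmetric binary generators $\mu$, $s$ and relations as in the context. The Koszul dual $\mathrm{SP}^!$ of $\mathrm{SP}$ is isomorphic to the operad $\mathrm{Ope}(\mathcal{G}^{\vee},\mathcal{R}')$, where $\mathcal{G}^{\vee}$ has two antisymmetric binary generators $\mu^{\vee}$, $s^{\vee}$ (so $\mu^\vee(x,y)=-\mu^\vee(y,x)$ and $s^\vee(x,y)=-s^\vee(y,x)$), and $\mathcal{R}'$ is the sub-species of $\mathrm{Free}_{\mathcal{G}^{\vee}}$ generated by $$s^{\vee}(a,s^{\vee}(b,c)),$$ $$\mu^{\vee}(a,s^{\vee}(b,c))+s^{\vee}(c,\mu^{\vee}(a,b))+s^{\vee}(b,\mu^{\vee}(c,a)),$$ $$\mu^{\vee}(a,\mu^{\vee}(b,c))+\mu^{\vee}(c,\mu^{\vee}(a,b))+\mu^{\vee}(b,\mu^{\vee}(c,a)).$$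
   Context: $\mathbb{K}$ is a field of characteristic $0$; operads are symmetric operads in $\mathbb{K}$-vector spaces, viewed as species (functors on finite sets and bijections) with partial compositions. For a species $\mathcal{G}$ concentrated on sets of cardinality 2, $\mathrm{Free}_{\mathcal{G}}$ is the free operad on $\mathcal{G}$ (trees with internal nodes decorated by $\mathcal{G}$, composition by grafting), $\mathrm{Free}_{\mathcal{G}}^{(2)}$ its part spanned by trees with two internal nodes, and $\mathrm{Ope}(\mathcal{G},\mathcal{R})=\mathrm{Free}_{\mathcal{G}}/(\mathcal{R})$, $(\mathcal{R})$ being the operad ideal generated by $\mathcal{R}$. The notation $p(x,q(y,z))$ means the grafting of $q$, with leaves $y,z$, on the second input of $p$. $\mathrm{SP}$: the sub-operad, generated by the edgeless graph $\mu$ and the segment graph $s$ on two vertices, of the operad of simple graphs in which $g_1\circ_* g_2$ is the sum over all graphs obtained from $g_1\sqcup g_2$ by removing $*$ and connecting each neighbour of $*$ in $g_1$ independently to an arbitrary vertex of $g_2$. It has the quadratic presentation $\mathrm{SP}\cong\mathrm{Ope}(\mathcal{G},\mathcal{R})$ where $\mathcal{G}$ has the two symmetric binary generators $\mu,s$ and $\mathcal{R}$ is the sub-species of $\mathrm{Free}_{\mathcal{G}}$ generated by $\mu(c,\mu(a,b))-\mu(a,\mu(b,c))$ and $s(a,\mu(b,c))-\mu(c,s(a,b))-\mu(b,s(a,c))$. Koszul dual: for a species $S$, $S^{\vee}[V]=S[V]^*$ with the action twisted by the signature, $S^{\vee}[\sigma](f)=\mathrm{sign}(\sigma)\,f\circ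 S[\sigma^{-1}]$. For a binary quadratic operad $\mathrm{Ope}(\mathcal{G},\mathcal{R})$, its Koszul dual is $\mathrm{Ope}(\mathcal{G}^{\vee},\mathcal{R}^{\perp})$, with $\mathcal{R}^{\perp}$ the orthogonal of $\mathcal{R}$ for the natural (sign-equivariant) pairing $\langle f_1\circ_* f_2\mid x_1\circ_* x_2\rangle=f_1(x_1)f_2(x_2)$ between $\mathrm{Free}_{\mathcal{G}^{\vee}}^{(2)}$ and $\mathrm{Free}_{\mathcal{G}}^{(2)}$. Explicitly here, on the label set $\{a,b,c\}$: for $p,q,p',q'\in\{s,\mu\}$ and $(x,y,z),(x',y',z')\in\{(a,b,c),(b,c,a),(c,a,b)\}$, $\langle p^{\vee}(x,q^{\vee}(y,z))\mid p'(x',q'(y',z'))\rangle$ equals $1$ if $p=p'$, $q=q'$, $(x,y,z)=(x',y',z')$, and $0$ otherwise. *)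

theory Defs
  imports "HOL-Library.Poly_Mapping" "HOL-Library.Infinite_Typeclass"
begin

section \<open>Vector spaces with explicit carriers\<close>

text \<open>
  The vector spaces below are quotients and duals of one another, so they are represented by
  records with an explicit carrier; the base field is a type of class \<open>field_char_0\<close>.
\<close>

record ('k, 'x) vspace =
  carr :: "'x set"
  vzero :: 'x
  vadd :: "'x \<Rightarrow> 'x \<Rightarrow> 'x"
  vscale :: "'k \<Rightarrow> 'x \<Rightarrow> 'x"

definition vsub :: "('k::field_char_0, 'x) vspace \<Rightarrow> 'x \<Rightarrow> 'x \<Rightarrow> 'x" where
  "vsub M x y = vadd M x (vscale M (- 1) y)"

definition is_subspace :: "('k, 'x) vspace \<Rightarrow> 'x set \<Rightarrow> bool" where
  "is_subspace M U \<longleftrightarrow>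
     U \<subseteq> carr M \<and> vzero M \<in> U \<and>
     (\<forall>x\<in>U. \<forall>y\<in>U. vadd M x y \<in> U) \<and> (\<forall>c. \<forall>x\<in>U. vscale M c x \<in> U)"

definition linear_map :: "('k, 'x) vspace \<Rightarrow> ('k, 'y) vspace \<Rightarrow> ('x \<Rightarrow> 'y) \<Rightarrow> bool" where
  "linear_map M N f \<longleftrightarrow>
     f ` carr M \<subseteq> carr N \<and>
     (\<forall>x\<in>carr M. \<forall>y\<in>carr M. f (vadd M x y) = vadd N (f x) (f y)) \<and>
     (\<forall>c. \<forall>x\<in>carr M. f (vscale M c x) = vscale N c (f x))"

definition base_space :: "('k::field_char_0, 'k) vspace" where
  "base_space = \<lparr>carr = UNIV, vzero = 0, vadd = (+), vscale = (*)\<rparr>"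

text \<open>
  Functionals are total functions of the ambient type; requiring them to vanish off the carrier
  makes the representation unique.
\<close>

definition dual_space :: "('k::field_char_0, 'x) vspace \<Rightarrow> ('k, 'x \<Rightarrow> 'k) vspace" where
  "dual_space M =
     \<lparr>carr = {f. linear_map M base_space f \<and> (\<forall>x. x \<notin> carr M \<longrightarrow> f x = 0)},
      vzero = (\<lambda>_. 0),
      vadd = (\<lambda>f g x. f x + g x),
      vscale = (\<lambda>c f x. c * f x)\<rparr>"

definition bilinear_form ::
  "('k::field_char_0, 'x) vspace \<Rightarrow> ('k, 'y) vspace \<Rightarrow> ('x \<Rightarrow> 'y \<Rightarrow> 'k) \<Rightarrow> bool" where
  "bilinear_form M N B \<longleftrightarrow>
     (\<forall>y\<in>carr N. (\<lambda>x. B x y) \<in> carr (dual_space M)) \<and>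
     (\<forall>x\<in>carr M. B x \<in> carr (dual_space N)) \<and>
     (\<forall>x y. x \<notin> carr M \<or> y \<notin> carr N \<longrightarrow> B x y = 0)"

definition coset :: "('k, 'x) vspace \<Rightarrow> 'x set \<Rightarrow> 'x \<Rightarrow> 'x set" where
  "coset M U x = vadd M x ` U"


section \<open>Species and operads\<close>

text \<open>
  The label type \<open>'l\<close> is infinite, and finite sets are finite subsets of it; only the values at
  finite sets are meaningful. \<open>act S V \<sigma> : S[V] \<rightarrow> S[\<sigma> ` V]\<close> is defined for \<open>\<sigma>\<close> injective
  on \<open>V\<close>. For an operad, \<open>pcomp P V W a\<close> is the partial composition
  \<open>\<circ>\<^sub>a : P[V + {a}] \<otimes> P[W] \<rightarrow> P[V + W]\<close>, for disjoint \<open>V\<close>, \<open>W\<close> and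
  \<open>a \<notin> V \<union> W\<close>, and \<open>opunit P a \<in> P[{a}]\<close> is the unit.
\<close>

record ('l, 'k, 'x) species =
  obj :: "'l set \<Rightarrow> ('k, 'x) vspace"
  act :: "'l set \<Rightarrow> ('l \<Rightarrow> 'l) \<Rightarrow> 'x \<Rightarrow> 'x"

record ('l, 'k, 'x) operad = "('l, 'k, 'x) species" +
  opunit :: "'l \<Rightarrow> 'x"
  pcomp :: "'l set \<Rightarrow> 'l set \<Rightarrow> 'l \<Rightarrow> 'x \<Rightarrow> 'x \<Rightarrow> 'x"

definition composable :: "'l set \<Rightarrow> 'l set \<Rightarrow> 'l \<Rightarrow> bool" where
  "composable V W a \<longleftrightarrow> finite V \<and> finite W \<and> V \<inter> W = {} \<and> a \<notin> V \<union> W"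

definition subspecies :: "('l, 'k, 'x, 'm) species_scheme \<Rightarrow> ('l set \<Rightarrow> 'x set) \<Rightarrow> bool" where
  "subspecies S R \<longleftrightarrow>
     (\<forall>V. finite V \<longrightarrow> is_subspace (obj S V) (R V)) \<and>
     (\<forall>V \<sigma>. finite V \<and> inj_on \<sigma> V \<longrightarrow> act S V \<sigma> ` R V \<subseteq> R (\<sigma> ` V))"

definition subspecies_gen ::
  "('l, 'k, 'x, 'm) species_scheme \<Rightarrow> ('l set \<Rightarrow> 'x set) \<Rightarrow> 'l set \<Rightarrow> 'x set" where
  "subspecies_gen S X V =
     \<Inter> {R V | R. subspecies S R \<and> (\<forall>U. finite U \<longrightarrow> X U \<subseteq> R U)}"

definition operad_ideal :: "('l, 'k, 'x) operad \<Rightarrow> ('l set \<Rightarrow> 'x set) \<Rightarrow> bool" where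
  "operad_ideal P I \<longleftrightarrow>
     subspecies P I \<and>
     (\<forall>V W a. composable V W a \<longrightarrow>
        (\<forall>f\<in>I (insert a V). \<forall>g\<in>carr (obj P W). pcomp P V W a f g \<in> I (V \<union> W)) \<and>
        (\<forall>f\<in>carr (obj P (insert a V)). \<forall>g\<in>I W. pcomp P V W a f g \<in> I (V \<union> W)))"

definition ideal_gen :: "('l, 'k, 'x) operad \<Rightarrow> ('l set \<Rightarrow> 'x set) \<Rightarrow> 'l set \<Rightarrow> 'x set" where
  "ideal_gen P X V =
     \<Inter> {I V | I. operad_ideal P I \<and> (\<forall>U. finite U \<longrightarrow> X U \<subseteq> I U)}"

text \<open>
  Elements of the quotient are cosets. Each operation returns the union of the cosets of its
  values on representatives, which for an ideal \<open>I\<close> is a single coset.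
\<close>

definition quotient_operad ::
  "('l, 'k, 'x) operad \<Rightarrow> ('l set \<Rightarrow> 'x set) \<Rightarrow> ('l, 'k, 'x set) operad" where
  "quotient_operad P I =
     \<lparr>obj = (\<lambda>V.
        \<lparr>carr = coset (obj P V) (I V) ` carr (obj P V),
         vzero = I V,
         vadd = (\<lambda>A B. \<Union>x\<in>A. \<Union>y\<in>B. coset (obj P V) (I V) (vadd (obj P V) x y)),
         vscale = (\<lambda>c A. \<Union>x\<in>A. coset (obj P V) (I V) (vscale (obj P V) c x))\<rparr>),
      act = (\<lambda>V \<sigma> A. \<Union>x\<in>A. coset (obj P (\<sigma> ` V)) (I (\<sigma> ` V)) (act P V \<sigma> x)),
      opunit = (\<lambda>a. coset (obj P {a}) (I {a}) (opunit P a)),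
      pcomp = (\<lambda>V W a A B.
        \<Union>x\<in>A. \<Union>y\<in>B. coset (obj P (V \<union> W)) (I (V \<union> W)) (pcomp P V W a x y))\<rparr>"

definition operad_isomorphism ::
  "('l, 'k, 'x) operad \<Rightarrow> ('l, 'k, 'y) operad \<Rightarrow> ('l set \<Rightarrow> 'x \<Rightarrow> 'y) \<Rightarrow> bool" where
  "operad_isomorphism P Q \<phi> \<longleftrightarrow>
     (\<forall>V. finite V \<longrightarrow>
        linear_map (obj P V) (obj Q V) (\<phi> V) \<and>
        bij_betw (\<phi> V) (carr (obj P V)) (carr (obj Q V))) \<and>
     (\<forall>V \<sigma>. finite V \<and> inj_on \<sigma> V \<longrightarrow>
        (\<forall>x\<in>carr (obj P V). \<phi> (\<sigma> ` V) (act P V \<sigma> x) = act Q V \<sigma> (\<phi> V x))) \<and>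
     (\<forall>a. \<phi> {a} (opunit P a) = opunit Q a) \<and>
     (\<forall>V W a. composable V W a \<longrightarrow>
        (\<forall>x\<in>carr (obj P (insert a V)). \<forall>y\<in>carr (obj P W).
           \<phi> (V \<union> W) (pcomp P V W a x y) = pcomp Q V W a (\<phi> (insert a V) x) (\<phi> W y)))"

definition operad_isomorphic :: "('l, 'k, 'x) operad \<Rightarrow> ('l, 'k, 'y) operad \<Rightarrow> bool" where
  "operad_isomorphic P Q \<longleftrightarrow> (\<exists>\<phi>. operad_isomorphism P Q \<phi>)"


section \<open>The free operad on a species concentrated on sets of cardinality 2\<close>

text \<open>
  \<open>Node f x s y t\<close> is the tree whose root is decorated by \<open>f \<in> G[{x, y}]\<close>, with \<open>s\<close> grafted on
  the input named \<open>x\<close> and \<open>t\<close> grafted on the input named \<open>y\<close>. Input names are local to the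
  node: they are identified up to renaming in the free operad and are unrelated to the leaf labels.
\<close>

datatype ('l, 'g) tree = Leaf 'l | Node 'g 'l "('l, 'g) tree" 'l "('l, 'g) tree"

primrec leaves :: "('l, 'g) tree \<Rightarrow> 'l set" where
  "leaves (Leaf a) = {a}"
| "leaves (Node f x s y t) = leaves s \<union> leaves t"

primrec nodes :: "('l, 'g) tree \<Rightarrow> nat" where
  "nodes (Leaf a) = 0"
| "nodes (Node f x s y t) = Suc (nodes s + nodes t)"

primrec relabel :: "('l \<Rightarrow> 'l) \<Rightarrow> ('l, 'g) tree \<Rightarrow> ('l, 'g) tree" where
  "relabel \<sigma> (Leaf a) = Leaf (\<sigma> a)"
| "relabel \<sigma> (Node f x s y t) = Node f x (relabel \<sigma> s) y (relabel \<sigma> t)"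

primrec graft :: "'l \<Rightarrow> ('l, 'g) tree \<Rightarrow> ('l, 'g) tree \<Rightarrow> ('l, 'g) tree" where
  "graft a (Leaf b) u = (if b = a then u else Leaf b)"
| "graft a (Node f x s y t) u = Node f x (graft a s u) y (graft a t u)"

primrec tree_over :: "('l, 'k, 'g) species \<Rightarrow> ('l, 'g) tree \<Rightarrow> bool" where
  "tree_over G (Leaf a) \<longleftrightarrow> True"
| "tree_over G (Node f x s y t) \<longleftrightarrow>
     x \<noteq> y \<and> f \<in> carr (obj G {x, y}) \<and> leaves s \<inter> leaves t = {} \<and>
     tree_over G s \<and> tree_over G t"

type_synonym ('l, 'k, 'g) tree_sum = "('l, 'g) tree \<Rightarrow>\<^sub>0 'k"

abbreviation tree_elt :: "('l, 'g) tree \<Rightarrow> ('l, 'k::field_char_0, 'g) tree_sum" where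
  "tree_elt t \<equiv> Poly_Mapping.single t 1"

definition formal_operad ::
  "('l, 'k::field_char_0, 'g) species \<Rightarrow> ('l, 'k, ('l, 'k, 'g) tree_sum) operad" where
  "formal_operad G =
     \<lparr>obj = (\<lambda>V.
        \<lparr>carr = {p. \<forall>t\<in>Poly_Mapping.keys p. tree_over G t \<and> leaves t = V},
         vzero = 0,
         vadd = (+),
         vscale = (\<lambda>c. Poly_Mapping.map ((*) c))\<rparr>),
      act = (\<lambda>V \<sigma> p. \<Sum>t\<in>Poly_Mapping.keys p.
               Poly_Mapping.single (relabel \<sigma> t) (Poly_Mapping.lookup p t)),
      opunit = (\<lambda>a. tree_elt (Leaf a)),
      pcomp = (\<lambda>V W a p q. \<Sum>s\<in>Poly_Mapping.keys p. \<Sum>t\<in>Poly_Mapping.keys q.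
               Poly_Mapping.single (graft a s t)
                 (Poly_Mapping.lookup p s * Poly_Mapping.lookup q t))\<rparr>"

definition corolla :: "'g \<Rightarrow> 'l \<Rightarrow> 'l \<Rightarrow> ('l, 'g) tree" where
  "corolla f x y = Node f x (Leaf x) y (Leaf y)"

text \<open>
  The relations turning formal combinations of decorated trees into trees decorated by tensors:
  linearity in the decoration, renaming of the inputs of a node, and irrelevance of the planar
  order of the inputs. The operadic ideal they generate imposes them at every node.
\<close>

inductive decoration_rel ::
  "('l, 'k::field_char_0, 'g) species \<Rightarrow> 'l set \<Rightarrow> ('l, 'k, 'g) tree_sum \<Rightarrow> bool"
  for G :: "('l, 'k, 'g) species" where
  add: "x \<noteq> y \<Longrightarrow> f \<in> carr (obj G {x, y}) \<Longrightarrow> g \<in> carr (obj G {x, y}) \<Longrightarrow>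
    decoration_rel G {x, y}
      (tree_elt (corolla (vadd (obj G {x, y}) f g) x y)
        - (tree_elt (corolla f x y) + tree_elt (corolla g x y)))"
| scale: "x \<noteq> y \<Longrightarrow> f \<in> carr (obj G {x, y}) \<Longrightarrow>
    decoration_rel G {x, y}
      (tree_elt (corolla (vscale (obj G {x, y}) c f) x y)
        - Poly_Mapping.single (corolla f x y) c)"
| rename: "x \<noteq> y \<Longrightarrow> f \<in> carr (obj G {x, y}) \<Longrightarrow> inj_on \<sigma> {x, y} \<Longrightarrow>
    decoration_rel G {\<sigma> x, \<sigma> y}
      (tree_elt (Node f x (Leaf (\<sigma> x)) y (Leaf (\<sigma> y)))
        - tree_elt (corolla (act G {x, y} \<sigma> f) (\<sigma> x) (\<sigma> y)))"
| swap: "x \<noteq> y \<Longrightarrow> f \<in> carr (obj G {x, y}) \<Longrightarrow>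
    decoration_rel G {x, y} (tree_elt (corolla f x y) - tree_elt (corolla f y x))"

definition tree_ideal ::
  "('l, 'k::field_char_0, 'g) species \<Rightarrow> 'l set \<Rightarrow> ('l, 'k, 'g) tree_sum set" where
  "tree_ideal G = ideal_gen (formal_operad G) (\<lambda>V. {r. decoration_rel G V r})"

type_synonym ('l, 'k, 'g) free_elt = "('l, 'k, 'g) tree_sum set"

definition free_operad ::
  "('l, 'k::field_char_0, 'g) species \<Rightarrow> ('l, 'k, ('l, 'k, 'g) free_elt) operad" where
  "free_operad G = quotient_operad (formal_operad G) (tree_ideal G)"

definition free_generator ::
  "('l, 'k::field_char_0, 'g) species \<Rightarrow> 'g \<Rightarrow> 'l \<Rightarrow> 'l \<Rightarrow> ('l, 'k, 'g) free_elt" where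
  "free_generator G f x y =
     coset (obj (formal_operad G) {x, y}) (tree_ideal G {x, y}) (tree_elt (corolla f x y))"

definition free_two ::
  "('l, 'k::field_char_0, 'g) species \<Rightarrow> 'l set \<Rightarrow> ('k, ('l, 'k, 'g) free_elt) vspace" where
  "free_two G V =
     (obj (free_operad G) V)
       \<lparr>carr := coset (obj (formal_operad G) V) (tree_ideal G V) `
          {p \<in> carr (obj (formal_operad G) V). \<forall>t\<in>Poly_Mapping.keys p. nodes t = 2}\<rparr>"

definition Ope ::
  "('l, 'k::field_char_0, 'g) species \<Rightarrow> ('l set \<Rightarrow> ('l, 'k, 'g) free_elt set) \<Rightarrow>
   ('l, 'k, ('l, 'k, 'g) free_elt set) operad" where
  "Ope G R = quotient_operad (free_operad G) (ideal_gen (free_operad G) R)"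

text \<open>
  \<open>p(x, q(y, z))\<close>, where \<open>p\<close> and \<open>q\<close> give for each ordered pair of labels an element of \<open>G\<close> on
  that pair. The result does not depend on the fresh label.
\<close>

definition nested ::
  "('l, 'k::field_char_0, 'g) species \<Rightarrow> ('l \<Rightarrow> 'l \<Rightarrow> 'g) \<Rightarrow> 'l \<Rightarrow> ('l \<Rightarrow> 'l \<Rightarrow> 'g) \<Rightarrow> 'l \<Rightarrow> 'l \<Rightarrow>
   ('l, 'k, 'g) free_elt" where
  "nested G p x q y z =
     (let a = (SOME a. a \<notin> {x, y, z}) in
        pcomp (free_operad G) {x} {y, z} a
          (free_generator G (p x a) x a) (free_generator G (q y z) y z))"


section \<open>Koszul duals of binary quadratic operads\<close>

text \<open>
  The signature of a bijection between two finite sets is taken with respect to the order of the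
  labels, i.e. it is the parity of its inversions. This is functorial, and it is the usual
  signature for permutations of a set.
\<close>

primrec inversions :: "'l::linorder list \<Rightarrow> nat" where
  "inversions [] = 0"
| "inversions (x # xs) = length (filter (\<lambda>y. y < x) xs) + inversions xs"

definition seq_sign :: "'l::linorder list \<Rightarrow> 'k::field_char_0" where
  "seq_sign xs = (- 1) ^ inversions xs"

definition bij_sign :: "'l::linorder set \<Rightarrow> ('l \<Rightarrow> 'l) \<Rightarrow> 'k::field_char_0" where
  "bij_sign V \<sigma> = seq_sign (map \<sigma> (sorted_list_of_set V))"

definition dual_species ::
  "('l::linorder, 'k::field_char_0, 'g) species \<Rightarrow> ('l, 'k, 'g \<Rightarrow> 'k) species" where
  "dual_species S =
     \<lparr>obj = (\<lambda>V. dual_space (obj S V)),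
      act = (\<lambda>V \<sigma> f x.
        if x \<in> carr (obj S (\<sigma> ` V))
        then bij_sign V \<sigma> * f (act S (\<sigma> ` V) (inv_into V \<sigma>) x) else 0)\<rparr>"

text \<open>
  The pairing \<open>\<langle>f\<^sub>1 \<circ>\<^sub>a f\<^sub>2 | g\<^sub>1 \<circ>\<^sub>a g\<^sub>2\<rangle> = f\<^sub>1(g\<^sub>1) f\<^sub>2(g\<^sub>2)\<close>, which is zero on trees of different
  shapes. As functionals carry the signature, each evaluation is relative to an ordering of its
  labels: \<open>f\<^sub>1(g\<^sub>1)\<close> to \<open>(x, a)\<close>, \<open>f\<^sub>2(g\<^sub>2)\<close> to \<open>(y, z)\<close>, and the pairing to \<open>(x, y, z)\<close>. These
  signs are what makes the pairing well defined and sign-equivariant; with them the pairing of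
  \<open>p\<^sup>\<or>(x, q\<^sup>\<or>(y, z))\<close> with \<open>p(x, q(y, z))\<close> is 1 for each of the three cyclic rotations
  \<open>(x, y, z)\<close> of three labels \<open>a < b < c\<close>.
\<close>

definition is_natural_pairing ::
  "('l::linorder, 'k::field_char_0, 'g) species \<Rightarrow> 'l set \<Rightarrow>
   (('l, 'k, 'g \<Rightarrow> 'k) free_elt \<Rightarrow> ('l, 'k, 'g) free_elt \<Rightarrow> 'k) \<Rightarrow> bool" where
  "is_natural_pairing G V B \<longleftrightarrow>
     bilinear_form (free_two (dual_species G) V) (free_two G V) B \<and>
     (\<forall>a x y z x' y' z' f1 f2 g1 g2.
        a \<notin> V \<and> distinct [x, y, z] \<and> {x, y, z} = V \<and> distinct [x', y', z'] \<and> {x', y', z'} = V \<and>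
        f1 \<in> carr (obj (dual_species G) {x, a}) \<and> f2 \<in> carr (obj (dual_species G) {y, z}) \<and>
        g1 \<in> carr (obj G {x', a}) \<and> g2 \<in> carr (obj G {y', z'}) \<longrightarrow>
        B (pcomp (free_operad (dual_species G)) {x} {y, z} a
             (free_generator (dual_species G) f1 x a) (free_generator (dual_species G) f2 y z))
          (pcomp (free_operad G) {x'} {y', z'} a
             (free_generator G g1 x' a) (free_generator G g2 y' z'))
        = (if x = x'
           then seq_sign [x, y, z] * (seq_sign [x, a] * f1 g1) * (seq_sign [y, z] * f2 g2)
           else 0))"

text \<open>
  Trees with two nodes have exactly three leaves and span, so a natural pairing is unique.
\<close>

definition natural_pairing ::
  "('l::linorder, 'k::field_char_0, 'g) species \<Rightarrow> 'l set \<Rightarrow>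
   ('l, 'k, 'g \<Rightarrow> 'k) free_elt \<Rightarrow> ('l, 'k, 'g) free_elt \<Rightarrow> 'k" where
  "natural_pairing G V = (THE B. is_natural_pairing G V B)"

definition orthogonal ::
  "('l::linorder, 'k::field_char_0, 'g) species \<Rightarrow> ('l set \<Rightarrow> ('l, 'k, 'g) free_elt set) \<Rightarrow>
   'l set \<Rightarrow> ('l, 'k, 'g \<Rightarrow> 'k) free_elt set" where
  "orthogonal G R V =
     {f \<in> carr (free_two (dual_species G) V). \<forall>r\<in>R V. natural_pairing G V f r = 0}"

definition koszul_dual ::
  "('l::linorder, 'k::field_char_0, 'g) species \<Rightarrow> ('l set \<Rightarrow> ('l, 'k, 'g) free_elt set) \<Rightarrow>
   ('l, 'k, ('l, 'k, 'g \<Rightarrow> 'k) free_elt set) operad" where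
  "koszul_dual G R = Ope (dual_species G) (orthogonal G R)"


section \<open>The operad SP\<close>

datatype sp_gen = Mu | Seg

text \<open>
  \<open>SP_species[V]\<close> has basis \<open>\<mu>\<close>, \<open>s\<close> if \<open>V\<close> has two elements and is zero otherwise; vectors are
  given by their coordinates. Bijections fix \<open>\<mu>\<close> and \<open>s\<close>.
\<close>

definition SP_species :: "('l, 'k::field_char_0, sp_gen \<Rightarrow> 'k) species" where
  "SP_species =
     \<lparr>obj = (\<lambda>V.
        \<lparr>carr = {f. card V = 2 \<or> f = (\<lambda>_. 0)},
         vzero = (\<lambda>_. 0),
         vadd = (\<lambda>f g p. f p + g p),
         vscale = (\<lambda>c f p. c * f p)\<rparr>),
      act = (\<lambda>V \<sigma> f. f)\<rparr>"

definition SP_gen :: "sp_gen \<Rightarrow> 'l \<Rightarrow> 'l \<Rightarrow> sp_gen \<Rightarrow> 'k::field_char_0" where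
  "SP_gen p x y = (\<lambda>q. if q = p then 1 else 0)"

definition SP_relations ::
  "'l \<Rightarrow> 'l \<Rightarrow> 'l \<Rightarrow> 'l set \<Rightarrow> ('l, 'k::field_char_0, sp_gen \<Rightarrow> 'k) free_elt set" where
  "SP_relations a b c =
     (let G = SP_species; F = obj (free_operad G) {a, b, c};
          \<mu> = SP_gen Mu; s = SP_gen Seg in
      subspecies_gen (free_operad G) (\<lambda>V. if V \<noteq> {a, b, c} then {} else
        {vsub F (nested G \<mu> c \<mu> a b) (nested G \<mu> a \<mu> b c),
         vsub F (vsub F (nested G s a \<mu> b c) (nested G \<mu> c s a b)) (nested G \<mu> b s a c)}))"

text \<open>
  \<open>SP_dual_gen p x y\<close> is \<open>p\<^sup>\<or>(x, y)\<close>: the coordinate functional \<open>p\<^sup>*\<close> if \<open>x < y\<close> and its opposite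
  if \<open>y < x\<close>.
\<close>

definition SP_dual_gen ::
  "sp_gen \<Rightarrow> 'l::linorder \<Rightarrow> 'l \<Rightarrow> (sp_gen \<Rightarrow> 'k) \<Rightarrow> 'k::field_char_0" where
  "SP_dual_gen p x y = (\<lambda>f. seq_sign [x, y] * f p)"

definition SP_dual_relations ::
  "'l::linorder \<Rightarrow> 'l \<Rightarrow> 'l \<Rightarrow> 'l set \<Rightarrow>
   ('l, 'k::field_char_0, (sp_gen \<Rightarrow> 'k) \<Rightarrow> 'k) free_elt set" where
  "SP_dual_relations a b c =
     (let G = dual_species SP_species; F = obj (free_operad G) {a, b, c};
          \<mu> = SP_dual_gen Mu; s = SP_dual_gen Seg in
      subspecies_gen (free_operad G) (\<lambda>V. if V \<noteq> {a, b, c} then {} else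
        {nested G s a s b c,
         vadd F (vadd F (nested G \<mu> a s b c) (nested G s c \<mu> a b)) (nested G s b \<mu> c a),
         vadd F (vadd F (nested G \<mu> a \<mu> b c) (nested G \<mu> c \<mu> a b)) (nested G \<mu> b \<mu> c a)}))"

definition has_two_antisymmetric_generators ::
  "('l, 'k::field_char_0, 'g) species \<Rightarrow> ('l \<Rightarrow> 'l \<Rightarrow> 'g) \<Rightarrow> ('l \<Rightarrow> 'l \<Rightarrow> 'g) \<Rightarrow> bool" where
  "has_two_antisymmetric_generators S p q \<longleftrightarrow>
     (\<forall>V. finite V \<and> card V \<noteq> 2 \<longrightarrow> carr (obj S V) = {vzero (obj S V)}) \<and>
     (\<forall>x y. x \<noteq> y \<longrightarrow>
        (\<forall>r\<in>{p, q}.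
           r x y \<in> carr (obj S {x, y}) \<and>
           r y x = vscale (obj S {x, y}) (- 1) (r x y) \<and>
           (\<forall>\<sigma>. inj_on \<sigma> {x, y} \<longrightarrow> act S {x, y} \<sigma> (r x y) = r (\<sigma> x) (\<sigma> y))) \<and>
        (\<forall>f\<in>carr (obj S {x, y}). \<exists>!cd.
           f = vadd (obj S {x, y}) (vscale (obj S {x, y}) (fst cd) (p x y))
                 (vscale (obj S {x, y}) (snd cd) (q x y))))"

end

theory Submission
  imports Defs
begin

text \<open>
  The two operads are even equal: an operadic ideal of the free operad on \<open>\<G>\<^sup>\<or>\<close> contains
  \<open>\<R>\<^sup>\<bottom>\<close> if and only if it contains the three given relations. On a set of three labels the
  two-node part of a free operad on two (anti)symmetric binary generators has the 12 elements
  \<open>p(x, q(y, z))\<close>, with \<open>(x, y, z)\<close> in a fixed cyclic class, as a basis. They span by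
  rewriting trees, and they are independent because the coefficient of \<open>p(x, q(y, z))\<close> can be
  computed by evaluating trees in a suitable five-dimensional algebra. In these coordinates the
  natural pairing is, up to a sign, the standard bilinear form, and \<open>\<R>\<^sup>\<bottom>\<close> is cut out by linear
  equations whose solutions are the combinations of the relabelled relations: the dimension count
  is \<open>12 = 5 + 7\<close>.
\<close>

section \<open>Formal sums of trees\<close>

text \<open>Equality in the free operad is membership in an ideal known only as an intersection, and
  no normal forms are at hand. Independence therefore calls for an ideal that contains all
  decoration relations and misses a given tree. Kernels of evaluation in an algebra are such ideals,
  because any algebra with the right symmetry respects these relations.

  Origin of the counts: relabelling associativity gives two independent relations and relabelling
  the derivation rule three, hence 5. On the dual side the relations of type s s and the mixed ones
  give three each, and the Jacobi relation, invariant up to sign, gives one, hence 7. These numbers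
  are realized by explicit coordinates: the seven free coordinates of an orthogonal element are the
  coefficients of the combination sought.

  The two inclusions are asymmetric. That the dual relations lie in the orthogonal is a claim about
  every element of the generated sub-species, so this one is first enclosed in a sub-species given
  by equations. The converse tests only against relabelled generators.\<close>

definition lin :: "('a \<Rightarrow> 'k) \<Rightarrow> ('a \<Rightarrow>\<^sub>0 'k) \<Rightarrow> 'k::field_char_0" where
  "lin \<phi> p = (\<Sum>t\<in>Poly_Mapping.keys p. Poly_Mapping.lookup p t * \<phi> t)"

abbreviation scl :: "'k::field_char_0 \<Rightarrow> ('a \<Rightarrow>\<^sub>0 'k) \<Rightarrow> 'a \<Rightarrow>\<^sub>0 'k" where
  "scl c \<equiv> Poly_Mapping.map ((*) c)"

lemma lookup_scl [simp]: "Poly_Mapping.lookup (scl c p) t = c * Poly_Mapping.lookup p t"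
  by transfer (auto simp: when_def)

lemma lin_superset:
  assumes "finite A" "Poly_Mapping.keys p \<subseteq> A"
  shows "lin \<phi> p = (\<Sum>t\<in>A. Poly_Mapping.lookup p t * \<phi> t)"
  unfolding lin_def using assms
  by (intro sum.mono_neutral_left) (auto simp: in_keys_iff)

lemma lin_add: "lin \<phi> (p + q) = lin \<phi> p + lin \<phi> q"
  unfolding lin_def by (rule setsum_keys_plus_distrib) (auto simp: algebra_simps)

lemma lin_zero [simp]: "lin \<phi> 0 = 0"
  by (simp add: lin_def)

lemma keys_scl: "Poly_Mapping.keys (scl c p) \<subseteq> Poly_Mapping.keys p"
  by (auto simp: in_keys_iff)

lemma lin_scl: "lin \<phi> (scl c p) = c * lin \<phi> p"
proof -
  have "lin \<phi> (scl c p) = (\<Sum>t\<in>Poly_Mapping.keys p. Poly_Mapping.lookup (scl c p) t * \<phi> t)"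
    by (rule lin_superset) (auto simp: keys_scl)
  then show ?thesis
    by (simp add: lin_def sum_distrib_left mult.assoc)
qed

lemma lin_single [simp]: "lin \<phi> (Poly_Mapping.single t c) = c * \<phi> t"
  by (cases "c = 0") (auto simp: lin_def)

lemma lin_uminus: "lin \<phi> (- p) = - lin \<phi> p"
  using lin_add[of \<phi> p "- p"] by (simp add: eq_neg_iff_add_eq_0 add.commute)

lemma lin_diff: "lin \<phi> (p - q) = lin \<phi> p - lin \<phi> q"
  using lin_add[of \<phi> p "- q"] by (simp add: lin_uminus)

lemma lin_sum: "lin \<phi> (sum f A) = (\<Sum>i\<in>A. lin \<phi> (f i))"
  by (induction A rule: infinite_finite_induct) (auto simp: lin_add)

lemmas lin_simps = lin_add lin_scl lin_uminus lin_diff lin_sum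

text \<open>Linear functionals separate formal sums. As every operation below is described by its
  effect under \<open>lin\<close>, identities between formal sums become identities in the
  field.\<close>

lemma lin_eqI:
  assumes "\<And>\<phi>. lin \<phi> p = lin \<phi> q"
  shows "p = q"
proof (rule poly_mapping_eqI)
  fix t
  have *: "lin (\<lambda>u. if u = t then 1 else 0) r = Poly_Mapping.lookup r t" for r :: "'a \<Rightarrow>\<^sub>0 'b"
    by (auto simp: lin_def if_distrib sum.delta' in_keys_iff cong: if_cong)
  show "Poly_Mapping.lookup p t = Poly_Mapping.lookup q t"
    using assms[of "\<lambda>u. if u = t then 1 else 0"] by (simp add: *)
qed

lemma lin_cong: "(\<And>t. t \<in> Poly_Mapping.keys p \<Longrightarrow> \<phi> t = \<psi> t) \<Longrightarrow> lin \<phi> p = lin \<psi> p"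
  by (simp add: lin_def)

lemma lin_fun_add: "lin (\<lambda>t. \<phi> t + \<psi> t) p = lin \<phi> p + lin \<psi> p"
  by (simp add: lin_def algebra_simps sum.distrib)

lemma lin_fun_mult: "lin (\<lambda>t. c * \<phi> t) p = c * lin \<phi> p"
  by (simp add: lin_def sum_distrib_left mult.left_commute)

lemma lin_fun_diff: "lin (\<lambda>t. \<phi> t - \<psi> t) p = lin \<phi> p - lin \<psi> p"
  by (simp add: lin_def algebra_simps sum_subtractf)

lemma poly_mapping_expand:
  "p = (\<Sum>t\<in>Poly_Mapping.keys p. scl (Poly_Mapping.lookup p t) (Poly_Mapping.single t 1))"
  by (rule lin_eqI) (simp add: lin_simps, simp add: lin_def)

lemma scl_minus_one [simp]: "scl (- 1) p = - p"
  by (rule lin_eqI) (simp add: lin_simps)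

lemma scl_zero_left [simp]: "scl 0 p = 0"
  by (rule lin_eqI) (simp add: lin_simps)

section \<open>Leaves of relabelled and grafted trees\<close>

lemma finite_leaves [simp]: "finite (leaves t)"
  by (induction t) auto

lemma leaves_relabel: "leaves (relabel \<sigma> t) = \<sigma> ` leaves t"
  by (induction t) auto

lemma nodes_relabel [simp]: "nodes (relabel \<sigma> t) = nodes t"
  by (induction t) auto

lemma tree_over_relabel: "tree_over G t \<Longrightarrow> inj_on \<sigma> (leaves t) \<Longrightarrow> tree_over G (relabel \<sigma> t)"
proof (induction t)
  case (Node f x s y t)
  then have "\<sigma> ` leaves s \<inter> \<sigma> ` leaves t = {}"
    using inj_on_image_Int[of \<sigma> "leaves s \<union> leaves t" "leaves s" "leaves t"] by simp
  then show ?case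
    using Node by (simp add: leaves_relabel inj_on_Un)
qed simp

lemma graft_notin: "a \<notin> leaves s \<Longrightarrow> graft a s u = s"
  by (induction s) auto

lemma leaves_graft: "a \<in> leaves s \<Longrightarrow> leaves (graft a s u) = (leaves s - {a}) \<union> leaves u"
proof (induction s)
  case (Node f x s y t)
  have "leaves (graft a r u) = (if a \<in> leaves r then (leaves r - {a}) \<union> leaves u else leaves r)"
    if "r = s \<or> r = t" for r
    using that Node.IH by (auto simp: graft_notin)
  then show ?case
    using Node.prems by auto
qed simp

lemma leaves_graft_subset: "leaves (graft a s u) \<subseteq> (leaves s - {a}) \<union> leaves u"
  by (cases "a \<in> leaves s") (auto simp: leaves_graft graft_notin)

lemma tree_over_graft:
  assumes "tree_over G s" "tree_over G u" "leaves u \<inter> (leaves s - {a}) = {}"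
  shows "tree_over G (graft a s u)"
  using assms
proof (induction s)
  case (Node f x s y t)
  have "leaves (graft a s u) \<inter> leaves (graft a t u) = {}"
  proof (cases "a \<in> leaves s")
    case True
    then have "a \<notin> leaves t"
      using Node.prems by auto
    then show ?thesis
      using Node.prems leaves_graft_subset[of a s u] by (auto simp: graft_notin)
  next
    case False
    then show ?thesis
      using Node.prems leaves_graft_subset[of a t u] by (auto simp: graft_notin)
  qed
  moreover have "tree_over G (graft a s u)" "tree_over G (graft a t u)"
    using Node.prems by (auto intro!: Node.IH)
  ultimately show ?case
    using Node.prems by simp
qed simp


section \<open>The operad of formal sums and its ideals\<close>

abbreviation fcarr :: "('l, 'k::field_char_0, 'g) species \<Rightarrow> 'l set \<Rightarrow> ('l, 'k, 'g) tree_sum set" where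
  "fcarr G V \<equiv> carr (obj (formal_operad G) V)"

abbreviation factn ::
  "('l, 'k::field_char_0, 'g) species \<Rightarrow> 'l set \<Rightarrow> ('l \<Rightarrow> 'l) \<Rightarrow> ('l, 'k, 'g) tree_sum \<Rightarrow> ('l, 'k, 'g) tree_sum"
  where "factn G V \<equiv> act (formal_operad G) V"

abbreviation fcmp ::
  "('l, 'k::field_char_0, 'g) species \<Rightarrow> 'l set \<Rightarrow> 'l set \<Rightarrow> 'l \<Rightarrow> ('l, 'k, 'g) tree_sum \<Rightarrow>
    ('l, 'k, 'g) tree_sum \<Rightarrow> ('l, 'k, 'g) tree_sum"
  where "fcmp G \<equiv> pcomp (formal_operad G)"

lemma fcarr_iff: "p \<in> fcarr G V \<longleftrightarrow> (\<forall>t\<in>Poly_Mapping.keys p. tree_over G t \<and> leaves t = V)"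
  by (simp add: formal_operad_def)

lemma formal_ops [simp]:
  "vzero (obj (formal_operad G) V) = 0"
  "vadd (obj (formal_operad G) V) = (+)"
  "vscale (obj (formal_operad G) V) = scl"
  by (simp_all add: formal_operad_def)

text \<open>Together with \<open>lin_fcmp\<close>, the dual description of the operations: a
  functional on trees is pulled back along relabelling or grafting. This replaces the double sums
  over keys in all later computations.\<close>

lemma lin_factn: "lin \<phi> (factn G V \<sigma> p) = lin (\<lambda>t. \<phi> (relabel \<sigma> t)) p"
  by (simp add: formal_operad_def lin_sum) (simp add: lin_def)

lemma lin_fcmp: "lin \<phi> (fcmp G V W a p q) = lin (\<lambda>s. lin (\<lambda>t. \<phi> (graft a s t)) q) p"
  by (simp add: formal_operad_def lin_sum) (simp add: lin_def sum_distrib_left mult.assoc)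

lemma factn_diff: "factn G V \<sigma> (p - q) = factn G V \<sigma> p - factn G V \<sigma> q"
  by (rule lin_eqI) (simp add: lin_simps lin_factn)

lemma fcmp_add_left: "fcmp G V W a (p + p') q = fcmp G V W a p q + fcmp G V W a p' q"
  and fcmp_diff_left: "fcmp G V W a (p - p') q = fcmp G V W a p q - fcmp G V W a p' q"
  and fcmp_scl_left: "fcmp G V W a (scl c p) q = scl c (fcmp G V W a p q)"
  by (rule lin_eqI, simp add: lin_simps lin_fcmp)+

lemma fcmp_add_right: "fcmp G V W a p (q + q') = fcmp G V W a p q + fcmp G V W a p q'"
  and fcmp_diff_right: "fcmp G V W a p (q - q') = fcmp G V W a p q - fcmp G V W a p q'"
  and fcmp_scl_right: "fcmp G V W a p (scl c q) = scl c (fcmp G V W a p q)"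
  and fcmp_single: "fcmp G V W a (Poly_Mapping.single s c) (Poly_Mapping.single t d) =
    Poly_Mapping.single (graft a s t) (c * d)"
  by (rule lin_eqI, simp add: lin_simps lin_fcmp lin_fun_add lin_fun_diff lin_fun_mult algebra_simps)+

section \<open>Generated ideals and generated sub-species\<close>

lemma ideal_gen_least:
  "operad_ideal P I \<Longrightarrow> (\<And>U. finite U \<Longrightarrow> X U \<subseteq> I U) \<Longrightarrow> ideal_gen P X V \<subseteq> I V"
  unfolding ideal_gen_def by blast

lemma ideal_gen_contains: "finite U \<Longrightarrow> X U \<subseteq> ideal_gen P X U"
  unfolding ideal_gen_def by blast

lemma subspecies_gen_least:
  "subspecies S R \<Longrightarrow> (\<And>U. finite U \<Longrightarrow> X U \<subseteq> R U) \<Longrightarrow> subspecies_gen S X V \<subseteq> R V"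
  unfolding subspecies_gen_def by blast

lemma subspecies_gen_contains: "finite U \<Longrightarrow> X U \<subseteq> subspecies_gen S X U"
  unfolding subspecies_gen_def by blast

lemma ideal_gen_iff:
  "f \<in> ideal_gen P X V \<longleftrightarrow>
    (\<forall>I. operad_ideal P I \<and> (\<forall>U. finite U \<longrightarrow> X U \<subseteq> I U) \<longrightarrow> f \<in> I V)"
  unfolding ideal_gen_def by auto

lemma subspecies_gen_iff:
  "f \<in> subspecies_gen S X V \<longleftrightarrow>
    (\<forall>R. subspecies S R \<and> (\<forall>U. finite U \<longrightarrow> X U \<subseteq> R U) \<longrightarrow> f \<in> R V)"
  unfolding subspecies_gen_def by auto

lemma subspaceD:
  assumes "is_subspace M U"
  shows "x \<in> U \<Longrightarrow> x \<in> carr M" "vzero M \<in> U" "x \<in> U \<Longrightarrow> y \<in> U \<Longrightarrow> vadd M x y \<in> U"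
    "x \<in> U \<Longrightarrow> vscale M c x \<in> U"
  using assms unfolding is_subspace_def by auto

lemma subspecies_subspace: "subspecies S R \<Longrightarrow> finite V \<Longrightarrow> is_subspace (obj S V) (R V)"
  and subspecies_act: "subspecies S R \<Longrightarrow> finite V \<Longrightarrow> inj_on \<sigma> V \<Longrightarrow> f \<in> R V \<Longrightarrow> act S V \<sigma> f \<in> R (\<sigma> ` V)"
  unfolding subspecies_def by blast+

lemma operad_ideal_subspecies: "operad_ideal P I \<Longrightarrow> subspecies P I"
  and operad_ideal_comp_left: "operad_ideal P I \<Longrightarrow> composable V W a \<Longrightarrow> f \<in> I (insert a V) \<Longrightarrow>
    g \<in> carr (obj P W) \<Longrightarrow> pcomp P V W a f g \<in> I (V \<union> W)"
  and operad_ideal_comp_right: "operad_ideal P I \<Longrightarrow> composable V W a \<Longrightarrow> f \<in> carr (obj P (insert a V)) \<Longrightarrow>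
    g \<in> I W \<Longrightarrow> pcomp P V W a f g \<in> I (V \<union> W)"
  unfolding operad_ideal_def by blast+

text \<open>The intersection of an empty family is the whole type, so containment in the carrier
  rests on the witness \<open>R\<close>; the other closure properties pass to any intersection. The
  same holds for \<open>operad_ideal_ideal_gen\<close>.\<close>

lemma subspecies_subspecies_gen:
  assumes R: "subspecies S R" "\<And>U. finite U \<Longrightarrow> X U \<subseteq> R U"
  shows "subspecies S (subspecies_gen S X)"
  unfolding subspecies_def is_subspace_def
proof (intro conjI allI impI ballI image_subsetI subsetI)
  fix V f assume "finite V" "f \<in> subspecies_gen S X V"
  then show "f \<in> carr (obj S V)"
    using R subspaceD(1)[OF subspecies_subspace[OF R(1)]] by (auto simp: subspecies_gen_iff)
qed (auto simp: subspecies_gen_iff intro: subspaceD[OF subspecies_subspace] subspecies_act)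

lemma operad_ideal_ideal_gen:
  assumes I: "operad_ideal P I" "\<And>U. finite U \<Longrightarrow> X U \<subseteq> I U"
  shows "operad_ideal P (ideal_gen P X)"
  unfolding operad_ideal_def subspecies_def is_subspace_def
proof (intro conjI allI impI ballI image_subsetI subsetI)
  fix V f assume "finite V" "f \<in> ideal_gen P X V"
  then show "f \<in> carr (obj P V)"
    using I subspaceD(1)[OF subspecies_subspace[OF operad_ideal_subspecies[OF I(1)]]]
    by (auto simp: ideal_gen_iff)
qed (auto simp: ideal_gen_iff
    intro: subspaceD[OF subspecies_subspace[OF operad_ideal_subspecies]]
      subspecies_act[OF operad_ideal_subspecies] operad_ideal_comp_left operad_ideal_comp_right)

text \<open>Operations of \<open>quotient_operad\<close> are unions over representatives; once the
  summands are shown to be one and the same coset, the union is that coset.\<close>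

lemma UN_UN_constant:
  "x \<in> A \<Longrightarrow> y \<in> B \<Longrightarrow> (\<And>r s. r \<in> A \<Longrightarrow> s \<in> B \<Longrightarrow> F r s = C) \<Longrightarrow> (\<Union>r\<in>A. \<Union>s\<in>B. F r s) = C"
  by auto

lemma subspace_fcarr: "is_subspace (obj (formal_operad G) V) (fcarr G V)"
  unfolding is_subspace_def
proof (intro conjI ballI allI)
  show "vadd (obj (formal_operad G) V) p q \<in> fcarr G V" if "p \<in> fcarr G V" "q \<in> fcarr G V" for p q
    using that keys_add[of p q] unfolding fcarr_iff formal_ops by blast
  show "vscale (obj (formal_operad G) V) c p \<in> fcarr G V" if "p \<in> fcarr G V" for c p
    using that keys_scl[of c p] unfolding fcarr_iff formal_ops by blast
  show "vzero (obj (formal_operad G) V) \<in> fcarr G V"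
    unfolding fcarr_iff formal_ops by simp
qed simp

lemma fcarr_zero [simp]: "0 \<in> fcarr G V"
  and fcarr_add: "p \<in> fcarr G V \<Longrightarrow> q \<in> fcarr G V \<Longrightarrow> p + q \<in> fcarr G V"
  and fcarr_scl: "p \<in> fcarr G V \<Longrightarrow> scl c p \<in> fcarr G V"
  using subspaceD(2-4)[OF subspace_fcarr] unfolding formal_ops by blast+

lemma fcarr_diff: "p \<in> fcarr G V \<Longrightarrow> q \<in> fcarr G V \<Longrightarrow> p - q \<in> fcarr G V"
  using fcarr_add[of p G V "- q"] fcarr_scl[of q G V "- 1"] by simp

lemma subspace_sum:
  fixes J :: "('l, 'k::field_char_0, 'g) tree_sum set"
  assumes "is_subspace (obj (formal_operad G) V) J" "\<And>i. i \<in> A \<Longrightarrow> f i \<in> J"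
  shows "sum f A \<in> J"
  using assms(2)
  by (induction A rule: infinite_finite_induct) (use assms(1) in \<open>auto simp: is_subspace_def\<close>)

lemma subspace_lin_mem:
  fixes J :: "('l, 'k::field_char_0, 'g) tree_sum set"
  assumes "is_subspace (obj (formal_operad G) V) J" "\<And>t. t \<in> Poly_Mapping.keys p \<Longrightarrow> tree_elt t \<in> J"
  shows "p \<in> J"
proof -
  have "(\<Sum>t\<in>Poly_Mapping.keys p. scl (Poly_Mapping.lookup p t) (tree_elt t)) \<in> J"
    using assms by (intro subspace_sum[OF assms(1)]) (auto simp: is_subspace_def simp del: map_single)
  then show ?thesis
    using poly_mapping_expand[of p] by simp
qed

lemma factn_fcarr:
  assumes "inj_on \<sigma> V" "p \<in> fcarr G V"
  shows "factn G V \<sigma> p \<in> fcarr G (\<sigma> ` V)"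
proof -
  have "factn G V \<sigma> p =
      (\<Sum>t\<in>Poly_Mapping.keys p. Poly_Mapping.single (relabel \<sigma> t) (Poly_Mapping.lookup p t))"
    by (simp add: formal_operad_def)
  also have "\<dots> \<in> fcarr G (\<sigma> ` V)"
    using assms
    by (intro subspace_sum[OF subspace_fcarr])
      (auto simp: fcarr_iff leaves_relabel intro!: tree_over_relabel)
  finally show ?thesis .
qed

lemma fcmp_fcarr:
  assumes "composable V W a" "p \<in> fcarr G (insert a V)" "q \<in> fcarr G W"
  shows "fcmp G V W a p q \<in> fcarr G (V \<union> W)"
proof -
  have *: "tree_over G (graft a s t) \<and> leaves (graft a s t) = V \<union> W"
    if "s \<in> Poly_Mapping.keys p" "t \<in> Poly_Mapping.keys q" for s t
  proof -
    have "tree_over G s" "leaves s = insert a V" "tree_over G t" "leaves t = W"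
      using assms that by (auto simp: fcarr_iff)
    moreover have "a \<notin> V" "V \<inter> W = {}"
      using assms by (auto simp: composable_def)
    ultimately show ?thesis
      by (auto simp: leaves_graft intro!: tree_over_graft)
  qed
  have "fcmp G V W a p q = (\<Sum>s\<in>Poly_Mapping.keys p. \<Sum>t\<in>Poly_Mapping.keys q.
      Poly_Mapping.single (graft a s t) (Poly_Mapping.lookup p s * Poly_Mapping.lookup q t))"
    by (simp add: formal_operad_def)
  also have "\<dots> \<in> fcarr G (V \<union> W)"
    using * by (intro subspace_sum[OF subspace_fcarr]) (auto simp: fcarr_iff)
  finally show ?thesis .
qed

text \<open>The operad is an ideal of itself. This is the witness that makes the family defining
  \<open>tree_ideal\<close> nonempty.\<close>

lemma operad_ideal_fcarr: "operad_ideal (formal_operad G) (fcarr G)"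
  unfolding operad_ideal_def subspecies_def
  by (intro conjI allI impI ballI image_subsetI) (simp_all add: subspace_fcarr factn_fcarr fcmp_fcarr)

section \<open>The free operad computed on representatives\<close>

definition cls :: "('l, 'k::field_char_0, 'g) species \<Rightarrow> 'l set \<Rightarrow> ('l, 'k, 'g) tree_sum \<Rightarrow> ('l, 'k, 'g) free_elt"
  where "cls G V = coset (obj (formal_operad G) V) (tree_ideal G V)"

text \<open>These closure conditions put every decoration relation into the carrier of the formal
  operad, which makes \<open>tree_ideal\<close> an ideal and the quotient operations well
  defined.\<close>

locale vector_species =
  fixes G :: "('l, 'k::field_char_0, 'g) species"
  assumes add_closed: "x \<noteq> y \<Longrightarrow> f \<in> carr (obj G {x, y}) \<Longrightarrow> g \<in> carr (obj G {x, y}) \<Longrightarrow>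
      vadd (obj G {x, y}) f g \<in> carr (obj G {x, y})"
    and scale_closed: "x \<noteq> y \<Longrightarrow> f \<in> carr (obj G {x, y}) \<Longrightarrow> vscale (obj G {x, y}) c f \<in> carr (obj G {x, y})"
    and act_closed: "x \<noteq> y \<Longrightarrow> f \<in> carr (obj G {x, y}) \<Longrightarrow> inj_on \<sigma> {x, y} \<Longrightarrow>
      act G {x, y} \<sigma> f \<in> carr (obj G {\<sigma> x, \<sigma> y})"
begin

lemma decoration_rel_fcarr: "decoration_rel G V r \<Longrightarrow> r \<in> fcarr G V"
proof (induction rule: decoration_rel.induct)
  case (add x y f g)
    then show ?case
      by (intro fcarr_diff fcarr_add) (auto simp: fcarr_iff corolla_def add_closed)
  next
    case (scale x y f c)
    then show ?case
      by (intro fcarr_diff) (auto simp: fcarr_iff corolla_def scale_closed)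
  next
    case (rename x y f \<sigma>)
    then show ?case
      by (intro fcarr_diff) (auto simp: fcarr_iff corolla_def act_closed inj_on_def)
  next
    case (swap x y f)
    then show ?case
      by (intro fcarr_diff) (auto simp: fcarr_iff corolla_def insert_commute)
qed

lemma operad_ideal_tree_ideal: "operad_ideal (formal_operad G) (tree_ideal G)"
  unfolding tree_ideal_def
  by (rule operad_ideal_ideal_gen[OF operad_ideal_fcarr]) (auto intro: decoration_rel_fcarr)

lemma tree_ideal_least:
  assumes "operad_ideal (formal_operad G) I" "\<And>U r. decoration_rel G U r \<Longrightarrow> r \<in> I U"
  shows "tree_ideal G V \<subseteq> I V"
  unfolding tree_ideal_def by (rule ideal_gen_least[OF assms(1)]) (auto intro: assms(2))

lemma tree_ideal_rel: "finite V \<Longrightarrow> decoration_rel G V r \<Longrightarrow> r \<in> tree_ideal G V"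
  unfolding tree_ideal_def using ideal_gen_contains[of V "\<lambda>V. {r. decoration_rel G V r}"] by blast

lemma tree_ideal_fcarr: "tree_ideal G V \<subseteq> fcarr G V"
  by (rule tree_ideal_least[OF operad_ideal_fcarr]) (auto intro: decoration_rel_fcarr)

context
  fixes V :: "'l set"
  assumes V: "finite V"
begin

lemma subspace_tree_ideal: "is_subspace (obj (formal_operad G) V) (tree_ideal G V)"
  using subspecies_subspace[OF operad_ideal_subspecies[OF operad_ideal_tree_ideal] V] .

lemma tree_ideal_zero: "0 \<in> tree_ideal G V"
  and tree_ideal_add: "p \<in> tree_ideal G V \<Longrightarrow> q \<in> tree_ideal G V \<Longrightarrow> p + q \<in> tree_ideal G V"
  and tree_ideal_scl: "p \<in> tree_ideal G V \<Longrightarrow> scl c p \<in> tree_ideal G V"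
  using subspace_tree_ideal unfolding is_subspace_def formal_ops by blast+

lemma tree_ideal_uminus: "p \<in> tree_ideal G V \<Longrightarrow> - p \<in> tree_ideal G V"
  using tree_ideal_scl[of p "- 1"] by simp

lemma tree_ideal_diff: "p \<in> tree_ideal G V \<Longrightarrow> q \<in> tree_ideal G V \<Longrightarrow> p - q \<in> tree_ideal G V"
  using tree_ideal_add[of p "- q"] tree_ideal_uminus[of q] by simp

lemma tree_ideal_act: "p \<in> tree_ideal G V \<Longrightarrow> inj_on \<sigma> V \<Longrightarrow> factn G V \<sigma> p \<in> tree_ideal G (\<sigma> ` V)"
  using subspecies_act[OF operad_ideal_subspecies[OF operad_ideal_tree_ideal] V] by blast

lemma cls_iff: "r \<in> cls G V p \<longleftrightarrow> r - p \<in> tree_ideal G V"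
  unfolding cls_def coset_def formal_ops by (auto simp: image_iff intro: bexI[of _ "r - p"])

lemma cls_self: "p \<in> cls G V p"
  using tree_ideal_zero by (simp add: cls_iff)

lemma cls_eq_iff: "cls G V p = cls G V q \<longleftrightarrow> p - q \<in> tree_ideal G V"
proof
  assume *: "p - q \<in> tree_ideal G V"
  have "r - p \<in> tree_ideal G V \<longleftrightarrow> r - q \<in> tree_ideal G V" for r
    using tree_ideal_add[OF _ *, of "r - p"] tree_ideal_diff[OF _ *, of "r - q"] by auto
  then show "cls G V p = cls G V q"
    by (auto simp: cls_iff)
next
  assume "cls G V p = cls G V q"
  then show "p - q \<in> tree_ideal G V"
    using cls_self[of p] cls_iff[of p q] by simp
qed

lemma free_carr: "carr (obj (free_operad G) V) = cls G V ` fcarr G V"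
  and free_zero: "vzero (obj (free_operad G) V) = cls G V 0"
  unfolding free_operad_def quotient_operad_def cls_def coset_def by auto

lemma free_add: "vadd (obj (free_operad G) V) (cls G V p) (cls G V q) = cls G V (p + q)"
proof -
  have "cls G V (r + s) = cls G V (p + q)" if "r \<in> cls G V p" "s \<in> cls G V q" for r s
    using tree_ideal_add[OF that[unfolded cls_iff]] by (simp add: cls_eq_iff algebra_simps)
  then have "(\<Union>r\<in>cls G V p. \<Union>s\<in>cls G V q. cls G V (r + s)) = cls G V (p + q)"
    by (intro UN_UN_constant[OF cls_self cls_self])
  then show ?thesis
    by (simp add: free_operad_def quotient_operad_def cls_def)
qed

lemma free_scale: "vscale (obj (free_operad G) V) c (cls G V p) = cls G V (scl c p)"
proof -
  have "cls G V (scl c r) = cls G V (scl c p)" if "r \<in> cls G V p" for r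
  proof -
    have "scl c r - scl c p = scl c (r - p)"
      by (rule lin_eqI) (simp add: lin_simps algebra_simps)
    then show ?thesis
      using tree_ideal_scl that by (simp add: cls_eq_iff cls_iff)
  qed
  then have "(\<Union>r\<in>cls G V p. cls G V (scl c r)) = cls G V (scl c p)"
    using cls_self by blast
  then show ?thesis
    by (simp add: free_operad_def quotient_operad_def cls_def)
qed

end

lemma free_act:
  assumes V: "finite V" and "inj_on \<sigma> V"
  shows "act (free_operad G) V \<sigma> (cls G V p) = cls G (\<sigma> ` V) (factn G V \<sigma> p)"
proof -
  have "cls G (\<sigma> ` V) (factn G V \<sigma> r) = cls G (\<sigma> ` V) (factn G V \<sigma> p)" if "r \<in> cls G V p" for r
    using assms that tree_ideal_act[of V "r - p" \<sigma>] by (simp add: cls_eq_iff cls_iff factn_diff)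
  then have "(\<Union>r\<in>cls G V p. cls G (\<sigma> ` V) (factn G V \<sigma> r)) = cls G (\<sigma> ` V) (factn G V \<sigma> p)"
    using cls_self[OF V] by blast
  then show ?thesis
    by (simp add: free_operad_def quotient_operad_def cls_def)
qed

lemma tree_ideal_comp:
  assumes "composable V W a"
  shows "p \<in> tree_ideal G (insert a V) \<Longrightarrow> q \<in> fcarr G W \<Longrightarrow> fcmp G V W a p q \<in> tree_ideal G (V \<union> W)"
    and "p \<in> fcarr G (insert a V) \<Longrightarrow> q \<in> tree_ideal G W \<Longrightarrow> fcmp G V W a p q \<in> tree_ideal G (V \<union> W)"
  using operad_ideal_comp_left[OF operad_ideal_tree_ideal assms]
    operad_ideal_comp_right[OF operad_ideal_tree_ideal assms] by blast+

lemma cls_fcarr: "finite V \<Longrightarrow> p \<in> fcarr G V \<Longrightarrow> q \<in> cls G V p \<Longrightarrow> q \<in> fcarr G V"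
  using tree_ideal_fcarr[of V] fcarr_add[of "q - p" G V p] by (auto simp: cls_iff)

text \<open>The difference of the two composites is the composite of \<open>r - p\<close> with
  \<open>s\<close> plus that of \<open>p\<close> with \<open>s - q\<close>. The ideal absorbs the
  first term because \<open>s\<close>, being congruent to \<open>q\<close>, again lies in the
  carrier.\<close>

lemma cls_fcmp:
  assumes "composable V W a" "p \<in> fcarr G (insert a V)" "q \<in> fcarr G W"
    "r \<in> cls G (insert a V) p" "s \<in> cls G W q"
  shows "cls G (V \<union> W) (fcmp G V W a r s) = cls G (V \<union> W) (fcmp G V W a p q)"
proof -
  have fin: "finite (insert a V)" "finite W" "finite (V \<union> W)"
    using assms by (auto simp: composable_def)
  have s: "s \<in> fcarr G W"
    using cls_fcarr fin assms by blast
  have "fcmp G V W a (r - p) s + fcmp G V W a p (s - q) \<in> tree_ideal G (V \<union> W)"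
    using assms fin s by (intro tree_ideal_add tree_ideal_comp) (auto simp: cls_iff)
  then show ?thesis
    using fin by (simp add: cls_eq_iff fcmp_diff_left fcmp_diff_right)
qed

lemma free_pcomp:
  assumes "composable V W a" "p \<in> fcarr G (insert a V)" "q \<in> fcarr G W"
  shows "pcomp (free_operad G) V W a (cls G (insert a V) p) (cls G W q) =
    cls G (V \<union> W) (fcmp G V W a p q)"
proof -
  have "finite (insert a V)" "finite W"
    using assms by (auto simp: composable_def)
  then have "(\<Union>r\<in>cls G (insert a V) p. \<Union>s\<in>cls G W q. cls G (V \<union> W) (fcmp G V W a r s)) =
      cls G (V \<union> W) (fcmp G V W a p q)"
    using cls_fcmp[OF assms] by (intro UN_UN_constant[OF cls_self cls_self])
  then show ?thesis
    by (simp add: free_operad_def quotient_operad_def cls_def)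
qed

end

section \<open>Binary generators and coordinates\<close>

definition tree2 :: "'g \<Rightarrow> 'g \<Rightarrow> 'l \<Rightarrow> 'l \<Rightarrow> 'l \<Rightarrow> 'l \<Rightarrow> ('l, 'g) tree" where
  "tree2 f g a x y z = Node f x (Leaf x) a (Node g y (Leaf y) z (Leaf z))"

text \<open>The choice made inside \<open>nested\<close>, under a name of its own. It depends on the
  set of labels alone, so all orders of three labels share one grafting point.\<close>

definition fresh :: "'l set \<Rightarrow> 'l" where
  "fresh V = (SOME a. a \<notin> V)"

lemma fresh_notin: "finite V \<Longrightarrow> fresh V \<notin> (V :: 'l::infinite set)"
  unfolding fresh_def by (rule someI_ex) (simp add: ex_new_if_finite infinite_UNIV)

text \<open>A two-node tree is given up to symmetry by the leaf at its root and the unordered pair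
  above. The rotations select one order of that pair for each of the three possible root
  leaves.\<close>

definition cyc :: "'l \<Rightarrow> 'l \<Rightarrow> 'l \<Rightarrow> ('l \<times> 'l \<times> 'l) set" where
  "cyc u v w = {(u, v, w), (v, w, u), (w, u, v)}"

text \<open>The assignment of \<open>e\<^sub>0\<close>, \<open>e\<^sub>1\<close>,
  \<open>e\<^sub>2\<close> to the leaves \<open>x\<close>, \<open>y\<close>, \<open>z\<close> and of
  the zero vector to all others, for the five-dimensional algebra of \<open>val\<close>.\<close>

definition unit_env :: "'l \<Rightarrow> 'l \<Rightarrow> 'l \<Rightarrow> 'l \<Rightarrow> nat \<Rightarrow> 'k::field_char_0" where
  "unit_env x y z l i = (if l = x \<and> i = 0 \<or> l = y \<and> i = 1 \<or> l = z \<and> i = 2 then 1 else 0)"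

lemma lin_fun_mult_right: "lin (\<lambda>t. \<phi> t * c) p = lin \<phi> p * c"
  by (simp add: lin_def sum_distrib_right mult.assoc)

lemma lin_swap: "lin (\<lambda>s. lin (\<lambda>t. \<phi> s t) q) p = lin (\<lambda>t. lin (\<lambda>s. \<phi> s t) p) q"
  unfolding lin_def sum_distrib_left by (subst sum.swap) (simp add: mult.left_commute)

lemma lin_fun_zero [simp]: "lin (\<lambda>t. 0) p = 0"
  by (simp add: lin_def)

text \<open>
  \<open>\<kappa> f x y r\<close> is the coordinate of \<open>f\<close> on the generator \<open>r(x, y)\<close>; generators are symmetric if
  \<open>\<epsilon> = 1\<close> and antisymmetric if \<open>\<epsilon> = - 1\<close>, so that an operad and its Koszul dual are treated alike.
\<close>

locale binary_generators = vector_species G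
  for G :: "('l::infinite, 'k::field_char_0, 'g) species" +
  fixes gen :: "sp_gen \<Rightarrow> 'l \<Rightarrow> 'l \<Rightarrow> 'g"
    and \<kappa> :: "'g \<Rightarrow> 'l \<Rightarrow> 'l \<Rightarrow> sp_gen \<Rightarrow> 'k"
    and \<epsilon> :: 'k
  assumes sign_square: "\<epsilon> * \<epsilon> = 1"
    and gen_closed: "x \<noteq> y \<Longrightarrow> gen p x y \<in> carr (obj G {x, y})"
    and coord_add: "x \<noteq> y \<Longrightarrow> f \<in> carr (obj G {x, y}) \<Longrightarrow> g \<in> carr (obj G {x, y}) \<Longrightarrow>
      \<kappa> (vadd (obj G {x, y}) f g) x y p = \<kappa> f x y p + \<kappa> g x y p"
    and coord_scale: "x \<noteq> y \<Longrightarrow> f \<in> carr (obj G {x, y}) \<Longrightarrow>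
      \<kappa> (vscale (obj G {x, y}) c f) x y p = c * \<kappa> f x y p"
    and coord_act: "x \<noteq> y \<Longrightarrow> f \<in> carr (obj G {x, y}) \<Longrightarrow> inj_on \<sigma> {x, y} \<Longrightarrow>
      \<kappa> (act G {x, y} \<sigma> f) (\<sigma> x) (\<sigma> y) p = \<kappa> f x y p"
    and coord_swap: "x \<noteq> y \<Longrightarrow> f \<in> carr (obj G {x, y}) \<Longrightarrow> \<kappa> f y x p = \<epsilon> * \<kappa> f x y p"
    and coord_gen: "x \<noteq> y \<Longrightarrow> \<kappa> (gen p x y) x y q = (if p = q then 1 else 0)"
    and expand: "x \<noteq> y \<Longrightarrow> f \<in> carr (obj G {x, y}) \<Longrightarrow>
      f = vadd (obj G {x, y}) (vscale (obj G {x, y}) (\<kappa> f x y Mu) (gen Mu x y))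
            (vscale (obj G {x, y}) (\<kappa> f x y Seg) (gen Seg x y))"
begin

text \<open>
  Evaluation of trees in the (anti)commutative algebra with basis \<open>e\<^sub>0, \<dots>, e\<^sub>4\<close> whose only
  nonzero products of basis elements are \<open>q(e\<^sub>1, e\<^sub>2) = e\<^sub>3\<close> and \<open>p(e\<^sub>0, e\<^sub>3) = e\<^sub>4\<close>, up to the order
  of the factors. The relations of the free operad hold in any algebra, and the \<open>e\<^sub>4\<close>-coordinate
  reads off the coefficient of \<open>p(x, q(y, z))\<close>.
\<close>

primrec val :: "sp_gen \<Rightarrow> sp_gen \<Rightarrow> ('l \<Rightarrow> nat \<Rightarrow> 'k) \<Rightarrow> ('l, 'g) tree \<Rightarrow> nat \<Rightarrow> 'k" where
  "val p q \<eta> (Leaf a) = \<eta> a"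
| "val p q \<eta> (Node f x s y t) = (\<lambda>i.
     if i = 3 then \<kappa> f x y q * (val p q \<eta> s 1 * val p q \<eta> t 2 + \<epsilon> * (val p q \<eta> s 2 * val p q \<eta> t 1))
     else if i = 4 then \<kappa> f x y p * (val p q \<eta> s 0 * val p q \<eta> t 3 + \<epsilon> * (val p q \<eta> s 3 * val p q \<eta> t 0))
     else 0)"

lemma val_local: "(\<And>a. a \<in> leaves t \<Longrightarrow> \<eta> a = \<theta> a) \<Longrightarrow> val p q \<eta> t = val p q \<theta> t"
  by (induction t) auto

lemma val_relabel: "val p q \<eta> (relabel \<sigma> t) = val p q (\<lambda>a. \<eta> (\<sigma> a)) t"
  by (induction t) auto

lemma val_graft: "val p q \<eta> (graft a s u) = val p q (\<eta>(a := val p q \<eta> u)) s"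
  by (induction s) auto

text \<open>The leaves of the two subtrees of a node are disjoint, so \<open>a\<close> occurs once
  and evaluation is linear in the vector placed there: at each node exactly one factor of every
  product depends on it.\<close>

lemma val_linear:
  assumes "tree_over G s" "a \<in> leaves s"
  shows "val p q (\<eta>(a := \<lambda>j. lin (\<lambda>t. \<phi> t j) Q)) s i = lin (\<lambda>t. val p q (\<eta>(a := \<phi> t)) s i) Q"
  using assms
proof (induction s arbitrary: i)
  case (Node f x s y t)
  consider "a \<in> leaves s" "a \<notin> leaves t" | "a \<in> leaves t" "a \<notin> leaves s"
    using Node.prems by auto
  then show ?case
  proof cases
    case 1
    then have t: "val p q (\<eta>(a := \<psi>)) t = val p q \<eta> t" for \<psi>
      by (intro val_local) auto
    have s: "val p q (\<eta>(a := \<lambda>j. lin (\<lambda>t. \<phi> t j) Q)) s i = lin (\<lambda>t. val p q (\<eta>(a := \<phi> t)) s i) Q" for i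
      by (intro Node.IH) (use Node.prems 1 in auto)
    show ?thesis
      by (simp del: fun_upd_apply add: t s lin_fun_mult lin_fun_mult_right lin_fun_add)
  next
    case 2
    then have s: "val p q (\<eta>(a := \<psi>)) s = val p q \<eta> s" for \<psi>
      by (intro val_local) auto
    have t: "val p q (\<eta>(a := \<lambda>j. lin (\<lambda>t. \<phi> t j) Q)) t i = lin (\<lambda>u. val p q (\<eta>(a := \<phi> u)) t i) Q" for i
      by (intro Node.IH) (use Node.prems 2 in auto)
    show ?thesis
      by (simp del: fun_upd_apply add: t s lin_fun_mult lin_fun_mult_right lin_fun_add)
  qed
qed simp

text \<open>All environments \<eta> and all coordinates are required to give zero, since composition
  and relabelling alter the environment.\<close>

definition vanishing :: "sp_gen \<Rightarrow> sp_gen \<Rightarrow> 'l set \<Rightarrow> ('l, 'k, 'g) tree_sum set" where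
  "vanishing p q V = {P \<in> fcarr G V. \<forall>\<eta> i. lin (\<lambda>t. val p q \<eta> t i) P = 0}"

text \<open>Grafting is substitution of values (\<open>val_graft\<close>). If the upper factor
  evaluates to zero, linearity at \<open>a\<close> turns the sum into a single evaluation with the
  zero vector at \<open>a\<close>. If the lower factor does, exchanging the sums leaves evaluations
  of that factor in modified environments.\<close>

lemma operad_ideal_vanishing: "operad_ideal (formal_operad G) (vanishing p q)"
  unfolding operad_ideal_def subspecies_def is_subspace_def
proof (intro conjI allI impI ballI image_subsetI subsetI)
  fix V W :: "'l set" and a P Q
  assume *: "composable V W a" "P \<in> fcarr G (insert a V)" "Q \<in> vanishing p q W"
  have "lin (\<lambda>t. val p q \<eta> t i) (fcmp G V W a P Q) = 0" for \<eta> i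
  proof -
    have "lin (\<lambda>t. val p q (\<eta>(a := val p q \<eta> t)) s i) Q = 0" if "s \<in> Poly_Mapping.keys P" for s
    proof -
      have "lin (\<lambda>t. val p q (\<eta>(a := val p q \<eta> t)) s i) Q = val p q (\<eta>(a := \<lambda>j. lin (\<lambda>t. val p q \<eta> t j) Q)) s i"
        using that * by (subst val_linear) (auto simp: fcarr_iff)
      \<comment> \<open>The zero vector is written as an empty linear combination, so that linearity
        at \<open>a\<close> applies a second time and yields 0.\<close>
      also have "\<dots> = lin (\<lambda>t. val p q (\<eta>(a := \<lambda>_. 0)) s i) 0"
      proof -
        have "(\<lambda>j. lin (\<lambda>t. val p q \<eta> t j) Q) = (\<lambda>j. lin (\<lambda>t::('l,'g) tree. 0) (0::('l, 'k, 'g) tree_sum))"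
          using * by (auto simp: vanishing_def)
        then show ?thesis
          using that * by (simp only:) (subst val_linear, auto simp: fcarr_iff)
      qed
      finally show ?thesis by simp
    qed
    then show ?thesis
      unfolding lin_fcmp val_graft by (simp add: lin_def)
  qed
  then show "fcmp G V W a P Q \<in> vanishing p q (V \<union> W)"
    using * by (auto simp: vanishing_def fcmp_fcarr)
next
  fix V W :: "'l set" and a P Q
  assume *: "composable V W a" "P \<in> vanishing p q (insert a V)" "Q \<in> fcarr G W"
  have "lin (\<lambda>t. val p q \<eta> t i) (fcmp G V W a P Q) =
      lin (\<lambda>t. lin (\<lambda>s. val p q (\<eta>(a := val p q \<eta> t)) s i) P) Q" for \<eta> i
    unfolding lin_fcmp val_graft by (rule lin_swap)
  then show "fcmp G V W a P Q \<in> vanishing p q (V \<union> W)"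
    using * by (auto simp: vanishing_def fcmp_fcarr)
qed (auto simp: vanishing_def lin_simps lin_factn val_relabel factn_fcarr fcarr_add fcarr_scl)

text \<open>Each relation mirrors an axiom on coordinates. For \<open>swap\<close>, one factor
  \<epsilon> comes from the coordinate and one from exchanging the arguments of the product, and
  their product is 1.\<close>

lemma decoration_rel_vanishing: "decoration_rel G V r \<Longrightarrow> r \<in> vanishing p q V"
  unfolding vanishing_def
proof (intro CollectI conjI allI)
  fix \<eta> i assume "decoration_rel G V r"
  then show "lin (\<lambda>t. val p q \<eta> t i) r = 0"
  proof (induction rule: decoration_rel.induct)
    case (swap x y f)
    have *: "\<epsilon> * (\<epsilon> * c) = c" for c
      using sign_square by (simp flip: mult.assoc)
    show ?case
      using swap by (simp add: lin_simps corolla_def coord_swap algebra_simps *)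
  next
    case (rename x y f \<sigma>)
    then show ?case
      using coord_act[of x y f \<sigma>] by (simp add: lin_simps corolla_def)
  qed (auto simp: lin_simps corolla_def coord_add coord_scale algebra_simps)
qed (rule decoration_rel_fcarr)

lemma tree_ideal_vanishing: "tree_ideal G V \<subseteq> vanishing p q V"
  by (rule tree_ideal_least[OF operad_ideal_vanishing decoration_rel_vanishing])

definition coord2 :: "sp_gen \<Rightarrow> sp_gen \<Rightarrow> 'l \<Rightarrow> 'l \<Rightarrow> 'l \<Rightarrow> ('l, 'k, 'g) tree_sum \<Rightarrow> 'k" where
  "coord2 p q x y z = lin (\<lambda>t. val p q (unit_env x y z) t 4)"

text \<open>Hence \<open>coord2\<close> descends to the free operad, which gives the independence of
  the generators.\<close>

lemma coord2_tree_ideal: "P \<in> tree_ideal G V \<Longrightarrow> coord2 p q x y z P = 0"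
  using tree_ideal_vanishing[of V p q] by (auto simp: coord2_def vanishing_def)

lemma coord2_simps:
  "coord2 p q x y z (P + Q) = coord2 p q x y z P + coord2 p q x y z Q"
  "coord2 p q x y z (P - Q) = coord2 p q x y z P - coord2 p q x y z Q"
  "coord2 p q x y z (scl c P) = c * coord2 p q x y z P"
  "coord2 p q x y z (sum F A) = (\<Sum>i\<in>A. coord2 p q x y z (F i))"
  "coord2 p q x y z 0 = 0"
  by (simp_all add: coord2_def lin_simps)

lemma coord2_factn:
  assumes "inj_on \<sigma> V" "{x, y, z} \<subseteq> V" "P \<in> fcarr G V"
  shows "coord2 p q (\<sigma> x) (\<sigma> y) (\<sigma> z) (factn G V \<sigma> P) = coord2 p q x y z P"
  unfolding coord2_def lin_factn val_relabel
proof (rule lin_cong)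
  fix t assume t: "t \<in> Poly_Mapping.keys P"
  have "val p q (\<lambda>a. unit_env (\<sigma> x) (\<sigma> y) (\<sigma> z) (\<sigma> a)) t = val p q (unit_env x y z) t"
  proof (rule val_local)
    fix a assume "a \<in> leaves t"
    then have "a \<in> V"
      using assms t by (auto simp: fcarr_iff)
    then have "\<sigma> a = \<sigma> b \<longleftrightarrow> a = b" if "b \<in> {x, y, z}" for b
      using that assms by (meson inj_on_eq_iff subsetD)
    then show "unit_env (\<sigma> x) (\<sigma> y) (\<sigma> z) (\<sigma> a) = (unit_env x y z a :: nat \<Rightarrow> 'k)"
      by (simp add: unit_env_def fun_eq_iff)
  qed
  then show "val p q (\<lambda>a. unit_env (\<sigma> x) (\<sigma> y) (\<sigma> z) (\<sigma> a)) t 4 = val p q (unit_env x y z) t 4"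
    by simp
qed

text \<open>If the root leaf is not \<open>x'\<close>, then \<open>e\<^sub>0\<close> is an argument
  of the upper product, which vanishes. Otherwise the upper pair is \<open>y'\<close>,
  \<open>z'\<close> in the same or in the opposite order, and the latter costs \<epsilon>.\<close>

lemma coord2_tree2:
  assumes "distinct [x, y, z]" "distinct [x', y', z']" "{x', y', z'} = {x, y, z}"
  shows "coord2 p q x' y' z' (tree_elt (tree2 f g a x y z)) =
    (if x = x' then \<kappa> f x a p * \<kappa> g y z q * (if y = y' then 1 else \<epsilon>) else 0)"
proof -
  have "x' = x \<and> y' = y \<and> z' = z \<or> x' = x \<and> y' = z \<and> z' = y \<or> x' = y \<and> y' = x \<and> z' = z \<or>
      x' = y \<and> y' = z \<and> z' = x \<or> x' = z \<and> y' = x \<and> z' = y \<or> x' = z \<and> y' = y \<and> z' = x"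
  proof -
    have "x' \<in> {x, y, z}" "y' \<in> {x, y, z}" "z' \<in> {x, y, z}"
      using assms(3) by blast+
    then show ?thesis
      using assms(2) by (elim insertE emptyE) simp_all
  qed
  then show ?thesis
    using assms(1) by (elim disjE) (simp_all add: coord2_def tree2_def unit_env_def)
qed

end

section \<open>Spanning of two-node trees by the generators\<close>

text \<open>Factors may be replaced by congruent ones even though \<open>J\<close> is only a
  subspace: the error terms fall into the tree ideal, which \<open>J\<close> contains.\<close>

lemma tree_ideal_comp_cong:
  fixes G :: "('l::infinite, 'k::field_char_0, 'g) species"
  assumes "vector_species G" "is_subspace (obj (formal_operad G) (V \<union> W)) J" "tree_ideal G (V \<union> W) \<subseteq> J"
    and comp: "composable V W a"
    and p: "p \<in> fcarr G (insert a V)" "p - p' \<in> tree_ideal G (insert a V)"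
    and q: "q' \<in> fcarr G W" "q - q' \<in> tree_ideal G W"
    and mem: "fcmp G V W a p' q' \<in> J"
  shows "fcmp G V W a p q \<in> J"
proof -
  interpret vector_species G by fact
  have "fcmp G V W a p (q - q') \<in> J" "fcmp G V W a (p - p') q' \<in> J"
    using assms tree_ideal_comp[OF comp] by blast+
  moreover have "fcmp G V W a p q = fcmp G V W a p (q - q') + fcmp G V W a (p - p') q' + fcmp G V W a p' q'"
    by (simp add: fcmp_diff_left fcmp_diff_right)
  ultimately show ?thesis
    using mem subspaceD(3)[OF assms(2)] by simp
qed

context binary_generators
begin

definition gen1 :: "sp_gen \<Rightarrow> 'l \<Rightarrow> 'l \<Rightarrow> ('l, 'k, 'g) tree_sum" where
  "gen1 p x y = tree_elt (corolla (gen p x y) x y)"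

definition gen2 :: "sp_gen \<Rightarrow> sp_gen \<Rightarrow> 'l \<Rightarrow> 'l \<Rightarrow> 'l \<Rightarrow> ('l, 'k, 'g) tree_sum" where
  "gen2 p q x y z =
     (let a = fresh {x, y, z} in tree_elt (tree2 (gen p x a) (gen q y z) a x y z))"

lemma gen1_fcarr: "x \<noteq> y \<Longrightarrow> gen1 p x y \<in> fcarr G {x, y}"
  by (auto simp: gen1_def fcarr_iff corolla_def gen_closed)

lemma fresh3: "fresh {x, y, z} \<noteq> (x :: 'l)" "fresh {x, y, z} \<noteq> y" "fresh {x, y, z} \<noteq> z"
  using fresh_notin[of "{x, y, z}"] by auto

lemma gen2_fcarr: "distinct [x, y, z] \<Longrightarrow> gen2 p q x y z \<in> fcarr G {x, y, z}"
  using fresh3[of x y z] by (auto simp: gen2_def Let_def fcarr_iff tree2_def gen_closed)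

lemma gen2_nodes: "t \<in> Poly_Mapping.keys (gen2 p q x y z) \<Longrightarrow> nodes t = 2"
  by (auto simp: gen2_def Let_def tree2_def)

lemma fcmp_corolla:
  assumes "x \<noteq> a"
  shows "fcmp G {x} {y, z} a (tree_elt (corolla f x a)) (tree_elt (corolla g y z)) =
    tree_elt (tree2 f g a x y z)"
  using assms by (simp add: fcmp_single tree2_def corolla_def)

lemma fcmp_gen1:
  assumes "a = fresh {x, y, z}"
  shows "fcmp G {x} {y, z} a (gen1 p x a) (gen1 q y z) = gen2 p q x y z"
  using fcmp_corolla[of x a y z] fresh3[of x y z] assms by (simp add: gen1_def gen2_def Let_def)

lemma free_generator_eq: "free_generator G f x y = cls G {x, y} (tree_elt (corolla f x y))"
  by (simp add: free_generator_def cls_def)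

lemma pcomp_free_generator:
  assumes "distinct [x, y, z]" "a \<notin> {x, y, z}" "f \<in> carr (obj G {x, a})" "g \<in> carr (obj G {y, z})"
  shows "pcomp (free_operad G) {x} {y, z} a (free_generator G f x a) (free_generator G g y z) =
    cls G {x, y, z} (tree_elt (tree2 f g a x y z))"
proof -
  have "composable {x} {y, z} a"
    using assms by (auto simp: composable_def)
  moreover have "x \<noteq> a"
    using assms by auto
  moreover have "tree_elt (corolla f x a) \<in> fcarr G {a, x}" "tree_elt (corolla g y z) \<in> fcarr G {y, z}"
    using assms by (auto simp: fcarr_iff corolla_def)
  ultimately show ?thesis
    using free_pcomp[of "{x}" "{y, z}" a "tree_elt (corolla f x a)" "tree_elt (corolla g y z)"]
      fcmp_corolla[OF \<open>x \<noteq> a\<close>, of y z f g] assms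
    by (simp add: free_generator_eq insert_commute)
qed

lemma nested_eq:
  assumes "distinct [x, y, z]"
  shows "nested G (gen p) x (gen q) y z = cls G {x, y, z} (gen2 p q x y z)"
  unfolding nested_def fresh_def[symmetric] Let_def
  using assms fresh3[of x y z]
  by (subst pcomp_free_generator) (auto simp: gen_closed gen2_def Let_def)

lemma coord2_gen2:
  assumes "distinct [x, y, z]" "distinct [x', y', z']" "{x', y', z'} = {x, y, z}"
  shows "coord2 p q x' y' z' (gen2 p' q' x y z) =
    (if x = x' \<and> p = p' \<and> q = q' then if y = y' then 1 else \<epsilon> else 0)"
proof -
  obtain a where a: "gen2 p' q' x y z = tree_elt (tree2 (gen p' x a) (gen q' y z) a x y z)" "x \<noteq> a"
    using fresh3(1)[of x y z] by (metis gen2_def)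
  show ?thesis
    unfolding a(1) coord2_tree2[OF assms] using assms(1) a(2) by (auto simp: coord_gen)
qed

text \<open>Rewriting at a single node: \<open>rename\<close> makes the input names equal to the
  leaf labels, then \<open>add\<close> and \<open>scale\<close> split the decoration along the
  generators. The second form inserts a \<open>swap\<close> in between, at the cost of
  \<epsilon>.\<close>

lemma one_node:
  assumes "x \<noteq> y" "u \<noteq> v" "f \<in> carr (obj G {x, y})"
  shows "tree_elt (Node f x (Leaf u) y (Leaf v)) -
    (scl (\<kappa> f x y Mu) (gen1 Mu u v) + scl (\<kappa> f x y Seg) (gen1 Seg u v)) \<in> tree_ideal G {u, v}" (is ?A)
    and one_node_swap: "tree_elt (Node f x (Leaf u) y (Leaf v)) -
    (scl (\<epsilon> * \<kappa> f x y Mu) (gen1 Mu v u) + scl (\<epsilon> * \<kappa> f x y Seg) (gen1 Seg v u)) \<in> tree_ideal G {u, v}" (is ?B)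
proof -
  define \<sigma> where "\<sigma> l = (if l = x then u else v)" for l
  have \<sigma>: "\<sigma> x = u" "\<sigma> y = v" "inj_on \<sigma> {x, y}"
    using assms by (auto simp: \<sigma>_def)
  define h where "h = act G {x, y} \<sigma> f"
  have h: "h \<in> carr (obj G {u, v})" "\<kappa> h u v p = \<kappa> f x y p" for p
    using act_closed[OF assms(1,3) \<sigma>(3)] coord_act[OF assms(1,3) \<sigma>(3)] \<sigma> by (auto simp: h_def)
  have ren: "tree_elt (Node f x (Leaf u) y (Leaf v)) - tree_elt (corolla h u v) \<in> tree_ideal G {u, v}"
    using decoration_rel.rename[OF assms(1,3) \<sigma>(3)] \<sigma> tree_ideal_rel by (simp add: h_def)
  have lin: "tree_elt (corolla k r s) -
      (scl (\<kappa> k r s Mu) (gen1 Mu r s) + scl (\<kappa> k r s Seg) (gen1 Seg r s)) \<in> tree_ideal G {r, s}"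
    if "r \<noteq> s" and k: "k \<in> carr (obj G {r, s})" for k r s
  proof -
    let ?s = "\<lambda>p. vscale (obj G {r, s}) (\<kappa> k r s p) (gen p r s)"
    have s: "?s p \<in> carr (obj G {r, s})" for p
      using that by (intro scale_closed gen_closed)
    have a: "tree_elt (corolla k r s) - (tree_elt (corolla (?s Mu) r s) + tree_elt (corolla (?s Seg) r s))
        \<in> tree_ideal G {r, s}"
      using decoration_rel.add[OF \<open>r \<noteq> s\<close> s[of Mu] s[of Seg]]
      by (intro tree_ideal_rel) (simp_all only: expand[OF that, symmetric], simp)
    have b: "tree_elt (corolla (?s p) r s) - scl (\<kappa> k r s p) (gen1 p r s) \<in> tree_ideal G {r, s}" for p
      using decoration_rel.scale[OF \<open>r \<noteq> s\<close> gen_closed[OF \<open>r \<noteq> s\<close>]]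
      by (intro tree_ideal_rel) (auto simp: gen1_def)
    show ?thesis
      using tree_ideal_add[OF _ a tree_ideal_add[OF _ b[of Mu] b[of Seg]]] by (simp add: algebra_simps)
  qed
  show ?A
    using tree_ideal_add[OF _ ren lin[OF assms(2) h(1)]] h(2) by (simp add: algebra_simps)
  have sw: "tree_elt (corolla h u v) - tree_elt (corolla h v u) \<in> tree_ideal G {u, v}"
    using decoration_rel.swap[OF assms(2) h(1)] by (intro tree_ideal_rel) auto
  have "\<kappa> h v u p = \<epsilon> * \<kappa> f x y p" for p
    using coord_swap[OF assms(2) h(1)] h(2) by simp
  then show ?B
    using tree_ideal_add[OF _ ren tree_ideal_add[OF _ sw lin[of v u h, unfolded insert_commute[of v u]]]] h(1) assms(2)
    by (simp add: algebra_simps)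
qed

lemma two_node_mem:
  assumes V: "distinct [x, y, z]" "a = fresh {x, y, z}"
    and J: "is_subspace (obj (formal_operad G) {x, y, z}) J" "tree_ideal G {x, y, z} \<subseteq> J"
    and gens: "\<And>p q. gen2 p q x y z \<in> J"
    and P: "P \<in> fcarr G {x, a}" "P - (scl c (gen1 Mu x a) + scl d (gen1 Seg x a)) \<in> tree_ideal G {x, a}"
    and Q: "Q - (scl c' (gen1 Mu y z) + scl d' (gen1 Seg y z)) \<in> tree_ideal G {y, z}"
  shows "fcmp G {x} {y, z} a P Q \<in> J"
proof -
  have comp: "composable {x} {y, z} a"
    using V fresh3[of x y z] by (auto simp: composable_def)
  have eq: "{x} \<union> {y, z} = {x, y, z}" "insert a {x} = {x, a}"
    by auto
  show ?thesis
  proof (rule tree_ideal_comp_cong[OF vector_species_axioms _ _ comp, unfolded eq])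
    show "scl c' (gen1 Mu y z) + scl d' (gen1 Seg y z) \<in> fcarr G {y, z}"
      using V by (intro fcarr_add fcarr_scl gen1_fcarr) auto
    show "fcmp G {x} {y, z} a (scl c (gen1 Mu x a) + scl d (gen1 Seg x a))
        (scl c' (gen1 Mu y z) + scl d' (gen1 Seg y z)) \<in> J"
      unfolding fcmp_add_left fcmp_add_right fcmp_scl_left fcmp_scl_right fcmp_gen1[OF V(2)]
      using gens subspaceD(3,4)[OF J(1)] by simp
  qed (use J P Q in auto)
qed

text \<open>The spanning statement, phrased as an induction rule: with different choices of
  \<open>J\<close> it shows both that linear maps are determined on the generators and that the
  coordinate expansion is valid.\<close>

lemma two_node_induct:
  assumes V: "distinct [u, v, w]"
    and J: "is_subspace (obj (formal_operad G) {u, v, w}) J" "tree_ideal G {u, v, w} \<subseteq> J"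
    and gens: "\<And>p q x y z. (x, y, z) \<in> cyc u v w \<Longrightarrow> gen2 p q x y z \<in> J"
    and P: "P \<in> fcarr G {u, v, w}" "\<And>t. t \<in> Poly_Mapping.keys P \<Longrightarrow> nodes t = 2"
  shows "P \<in> J"
proof (rule subspace_lin_mem[OF J(1)])
  fix t assume "t \<in> Poly_Mapping.keys P"
  then have t: "tree_over G t" "leaves t = {u, v, w}" "nodes t = 2"
    using P by (auto simp: fcarr_iff)
  have Leaf: "nodes s = 0 \<Longrightarrow> \<exists>l. s = Leaf l" for s :: "('l, 'g) tree"
    by (cases s) auto
  have corolla: "nodes s = Suc 0 \<Longrightarrow> \<exists>g y m z n. s = Node g y (Leaf m) z (Leaf n)" for s :: "('l, 'g) tree"
    using Leaf by (cases s) auto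
  obtain f x y l g x' m y' n where shape:
    "t = Node f x (Leaf l) y (Node g x' (Leaf m) y' (Leaf n)) \<or>
     t = Node f x (Node g x' (Leaf m) y' (Leaf n)) y (Leaf l)"
  proof (cases t)
    case (Node f x s1 y s2)
    then have "nodes s1 = 0 \<and> nodes s2 = Suc 0 \<or> nodes s1 = Suc 0 \<and> nodes s2 = 0"
      using t(3) by auto
    then show ?thesis
      using Leaf corolla Node that by metis
  qed (use t in auto)
  have d: "distinct [l, m, n]" "{l, m, n} = {u, v, w}" "x \<noteq> y" "x' \<noteq> y'"
    and fg: "f \<in> carr (obj G {x, y})" "g \<in> carr (obj G {x', y'})"
    using shape t by (elim disjE; fastforce)+
  define a where "a = fresh {l, m, n}"
  have a: "a \<noteq> l" "a \<noteq> m" "a \<noteq> n"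
    using fresh3[of l m n] by (auto simp: a_def)
  define Q where "Q = (tree_elt (Node g x' (Leaf m) y' (Leaf n)) :: ('l, 'k, 'g) tree_sum)"
  \<comment> \<open>The root of \<open>t\<close> with its upper node replaced by the leaf
    \<open>a\<close>, so that \<open>t\<close> is the composite of \<open>R\<close> and
    \<open>Q\<close>. The case distinction records on which input of the root the upper node
    sits.\<close>
  define R where "R = (if t = Node f x (Leaf l) y (Node g x' (Leaf m) y' (Leaf n))
      then tree_elt (Node f x (Leaf l) y (Leaf a))
      else tree_elt (Node f x (Leaf a) y (Leaf l)) :: ('l, 'k, 'g) tree_sum)"
  have R: "R \<in> fcarr G {l, a}"
    using d fg a by (auto simp: R_def fcarr_iff)
  have "\<exists>c d. R - (scl c (gen1 Mu l a) + scl d (gen1 Seg l a)) \<in> tree_ideal G {l, a}"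
    using one_node[OF d(3) a(1)[symmetric] fg(1)] one_node_swap[OF d(3) a(1) fg(1)]
    unfolding R_def insert_commute[of a l] by (simp split: if_split) blast
  then obtain c c' where R': "R - (scl c (gen1 Mu l a) + scl c' (gen1 Seg l a)) \<in> tree_ideal G {l, a}"
    by blast
  have "m \<noteq> n" using d by auto
  have mem: "fcmp G {l} {m, n} a R Q \<in> J"
  proof -
    \<comment> \<open>One of the two orders of the upper pair belongs to the chosen cyclic class; if
      it is the reversed one, \<open>Q\<close> is expanded with
      \<open>one_node_swap\<close>.\<close>
    have "(l, m, n) \<in> cyc u v w \<or> (l, n, m) \<in> cyc u v w"
    proof -
      have "l \<in> {u, v, w}" "m \<in> {u, v, w}" "n \<in> {u, v, w}"
        using d(2) by blast+
      then show ?thesis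
        using d(1) by (elim insertE emptyE) (simp_all add: cyc_def)
    qed
    then show ?thesis
    proof
      assume *: "(l, m, n) \<in> cyc u v w"
      show ?thesis
      proof (rule two_node_mem[OF d(1) a_def])
        show "Q - (scl (\<kappa> g x' y' Mu) (gen1 Mu m n) + scl (\<kappa> g x' y' Seg) (gen1 Seg m n)) \<in> tree_ideal G {m, n}"
          using one_node[OF d(4) \<open>m \<noteq> n\<close> fg(2)] by (simp only: Q_def)
      qed (rule R' | simp only: d(2) J gens[OF *] R)+
    next
      assume *: "(l, n, m) \<in> cyc u v w"
      have e: "{n, m} = {m, n}" "{l, n, m} = {l, m, n}" "distinct [l, n, m]"
        using d by auto
      show ?thesis
      proof (rule two_node_mem[OF e(3), unfolded e, OF a_def])
        show "Q - (scl (\<epsilon> * \<kappa> g x' y' Mu) (gen1 Mu n m) + scl (\<epsilon> * \<kappa> g x' y' Seg) (gen1 Seg n m))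
            \<in> tree_ideal G {m, n}"
          using one_node_swap[OF d(4) \<open>m \<noteq> n\<close> fg(2)] by (simp only: Q_def)
      qed (rule R' | simp only: d(2) J gens[OF *] R)+
    qed
  qed
  have "fcmp G {l} {m, n} a R Q = tree_elt t"
    using shape a by (auto simp: R_def Q_def fcmp_single)
  then show "tree_elt t \<in> J"
    using mem by simp
qed

end

section \<open>The two-node part and its coordinates\<close>

definition two_nodes :: "('l, 'k::field_char_0, 'g) species \<Rightarrow> 'l set \<Rightarrow> ('l, 'k, 'g) tree_sum set" where
  "two_nodes G V = {p \<in> fcarr G V. \<forall>t\<in>Poly_Mapping.keys p. nodes t = 2}"

lemma two_nodes_fcarr: "p \<in> two_nodes G V \<Longrightarrow> p \<in> fcarr G V"
  by (simp add: two_nodes_def)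

lemma subspace_two_nodes: "is_subspace (obj (formal_operad G) V) (two_nodes G V)"
  unfolding is_subspace_def two_nodes_def formal_ops
  using keys_add keys_scl by (fastforce simp: fcarr_add fcarr_scl)

lemma two_nodes_zero: "0 \<in> two_nodes G V"
  and two_nodes_add: "p \<in> two_nodes G V \<Longrightarrow> q \<in> two_nodes G V \<Longrightarrow> p + q \<in> two_nodes G V"
  and two_nodes_scl: "p \<in> two_nodes G V \<Longrightarrow> scl c p \<in> two_nodes G V"
  using subspaceD(2-4)[OF subspace_two_nodes] unfolding formal_ops by blast+

lemma two_nodes_diff: "p \<in> two_nodes G V \<Longrightarrow> q \<in> two_nodes G V \<Longrightarrow> p - q \<in> two_nodes G V"
  using two_nodes_add[of p G V "- q"] two_nodes_scl[of q G V "- 1"] by simp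

lemma factn_two_nodes:
  assumes "inj_on \<sigma> V" "p \<in> two_nodes G V"
  shows "factn G V \<sigma> p \<in> two_nodes G (\<sigma> ` V)"
proof -
  have "factn G V \<sigma> p =
      (\<Sum>t\<in>Poly_Mapping.keys p. Poly_Mapping.single (relabel \<sigma> t) (Poly_Mapping.lookup p t))"
    by (simp add: formal_operad_def)
  also have "\<dots> \<in> two_nodes G (\<sigma> ` V)"
    using assms
    by (intro subspace_sum[OF subspace_two_nodes])
      (auto simp: fcarr_iff two_nodes_def leaves_relabel intro!: tree_over_relabel)
  finally show ?thesis .
qed

lemma carr_free_two: "carr (free_two G V) = cls G V ` two_nodes G V"
  and free_two_add: "vadd (free_two G V) = vadd (obj (free_operad G) V)"
  and free_two_scale: "vscale (free_two G V) = vscale (obj (free_operad G) V)"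
  by (simp_all add: free_two_def two_nodes_def cls_def)

lemma card_leaves: "tree_over G t \<Longrightarrow> card (leaves t) = Suc (nodes t)"
  by (induction t) (auto simp: card_Un_disjoint)

text \<open>A binary tree with two nodes has three leaves; on all other sets an orthogonal element
  is thus the zero class.\<close>

lemma two_nodes_trivial:
  assumes "card V \<noteq> 3"
  shows "two_nodes G V = {0}"
proof -
  have "p = 0" if "p \<in> two_nodes G V" for p
  proof -
    have "Poly_Mapping.keys p = {}"
      using that assms card_leaves[of G] by (fastforce simp: two_nodes_def fcarr_iff)
    then show ?thesis by simp
  qed
  then show ?thesis
    using two_nodes_zero by blast
qed

context binary_generators
begin

lemma gen2_two_nodes: "distinct [x, y, z] \<Longrightarrow> {x, y, z} = V \<Longrightarrow> gen2 p q x y z \<in> two_nodes G V"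
  using gen2_fcarr[of x y z p q] gen2_nodes unfolding two_nodes_def by auto

lemma cyc_distinct:
  "distinct [u, v, w] \<Longrightarrow> (x, y, z) \<in> cyc u v w \<Longrightarrow> distinct [x, y, z] \<and> {x, y, z} = {u, v, w}"
  by (auto simp: cyc_def)

lemma two_nodes_linear_eq:
  assumes V: "distinct [u, v, w]" "{u, v, w} = V"
    and lin: "linear_map (free_two G V) base_space \<phi>" "linear_map (free_two G V) base_space \<psi>"
    and eq: "\<And>p q x y z. (x, y, z) \<in> cyc u v w \<Longrightarrow> \<phi> (cls G V (gen2 p q x y z)) = \<psi> (cls G V (gen2 p q x y z))"
    and f: "f \<in> carr (free_two G V)"
  shows "\<phi> f = \<psi> f"
proof -
  have fin: "finite V"
    using V by auto
  have add: "\<chi> (cls G V (P + Q)) = \<chi> (cls G V P) + \<chi> (cls G V Q)"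
    and scale: "\<chi> (cls G V (scl c P)) = c * \<chi> (cls G V P)"
    if "linear_map (free_two G V) base_space \<chi>" "P \<in> two_nodes G V" "Q \<in> two_nodes G V" for \<chi> P Q c
    using that fin
    by (auto simp: linear_map_def carr_free_two free_two_add free_two_scale free_add free_scale base_space_def
        simp flip: free_add free_scale)
  \<comment> \<open>\<open>J\<close> has to contain the whole tree ideal, hence sums merely congruent to two-node ones.\<close>
  define J where "J = {P \<in> fcarr G V. \<exists>Q\<in>two_nodes G V. P - Q \<in> tree_ideal G V \<and> \<phi> (cls G V Q) = \<psi> (cls G V Q)}"
  have "is_subspace (obj (formal_operad G) V) J"
    unfolding is_subspace_def formal_ops
  proof (intro conjI ballI allI)
    show "J \<subseteq> fcarr G V"
      by (auto simp: J_def)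
    show "0 \<in> J"
      using two_nodes_zero[of G V] scale[OF lin(1), of 0 0 0] scale[OF lin(2), of 0 0 0] tree_ideal_zero[OF fin]
      by (auto simp: J_def intro!: bexI[of _ 0])
    fix P P' assume "P \<in> J"
    then obtain Q where Q: "P \<in> fcarr G V" "Q \<in> two_nodes G V" "P - Q \<in> tree_ideal G V" "\<phi> (cls G V Q) = \<psi> (cls G V Q)"
      by (auto simp: J_def)
    show "scl c P \<in> J" for c
    proof -
      have "scl c P - scl c Q = scl c (P - Q)"
        by (rule lin_eqI) (simp add: lin_simps algebra_simps)
      then show ?thesis
        using Q fin scale[OF lin(1)] scale[OF lin(2)]
        by (auto simp: J_def fcarr_scl two_nodes_scl tree_ideal_scl intro!: bexI[of _ "scl c Q"])
    qed
    assume "P' \<in> J"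
    then obtain Q' where Q': "P' \<in> fcarr G V" "Q' \<in> two_nodes G V" "P' - Q' \<in> tree_ideal G V" "\<phi> (cls G V Q') = \<psi> (cls G V Q')"
      by (auto simp: J_def)
    have "P + P' - (Q + Q') \<in> tree_ideal G V"
      using tree_ideal_add[OF fin Q(3) Q'(3)] by (simp add: algebra_simps)
    then show "P + P' \<in> J"
      using Q Q' add[OF lin(1)] add[OF lin(2)]
      by (auto simp: J_def fcarr_add two_nodes_add intro!: bexI[of _ "Q + Q'"])
  qed
  moreover have "tree_ideal G V \<subseteq> J"
  proof
    fix P assume "P \<in> tree_ideal G V"
    moreover have "\<phi> (cls G V 0) = \<psi> (cls G V 0)"
      using scale[OF lin(1), of 0 0 0] scale[OF lin(2), of 0 0 0] two_nodes_zero[of G V] by simp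
    ultimately show "P \<in> J"
      using tree_ideal_fcarr[of V] two_nodes_zero[of G V] by (auto simp: J_def intro!: bexI[of _ 0])
  qed
  moreover have "gen2 p q x y z \<in> J" if "(x, y, z) \<in> cyc u v w" for p q x y z
    using cyc_distinct[OF V(1) that] eq[OF that, of p q] tree_ideal_zero[OF fin] gen2_two_nodes[of x y z V p q] V
    by (auto simp: J_def two_nodes_fcarr intro!: bexI[of _ "gen2 p q x y z"])
  moreover obtain P where P: "P \<in> two_nodes G V" "f = cls G V P"
    using f by (auto simp: carr_free_two)
  ultimately have "P \<in> J"
    using two_node_induct[OF V(1), of J P] V(2) by (auto simp: two_nodes_def)
  then show ?thesis
    using fin P by (auto simp: J_def simp flip: cls_eq_iff)
qed

text \<open>The part of the coordinate expansion carried by trees with root leaf \<open>x\<close>;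
  the three rotations add up to the full expansion.\<close>

definition expand2 :: "'l \<Rightarrow> 'l \<Rightarrow> 'l \<Rightarrow> ('l, 'k, 'g) tree_sum \<Rightarrow> ('l, 'k, 'g) tree_sum" where
  "expand2 x y z P =
     scl (coord2 Mu Mu x y z P) (gen2 Mu Mu x y z) + scl (coord2 Mu Seg x y z P) (gen2 Mu Seg x y z) +
     scl (coord2 Seg Mu x y z P) (gen2 Seg Mu x y z) + scl (coord2 Seg Seg x y z P) (gen2 Seg Seg x y z)"

lemma scl_left_simps: "scl (c + d) P = scl c P + scl d P" "scl (c * d) P = scl c (scl d P)" "scl 1 P = P"
    "scl c (P + Q) = scl c P + scl c Q" for P Q :: "('l, 'k, 'g) tree_sum"
  by (rule lin_eqI, simp add: lin_simps algebra_simps)+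

lemma expand2_simps:
  "expand2 x y z (P + Q) = expand2 x y z P + expand2 x y z Q"
  "expand2 x y z (scl c P) = scl c (expand2 x y z P)"
  by (simp_all add: expand2_def coord2_simps scl_left_simps algebra_simps)

text \<open>The expansion is linear in \<open>P\<close> and fixes each generator, since the
  generators have Kronecker coordinates. Hence the sums for which it is correct form a subspace to
  which \<open>two_node_induct\<close> applies.\<close>

lemma two_nodes_expand:
  assumes V: "distinct [u, v, w]" and P: "P \<in> two_nodes G {u, v, w}"
  shows "P - (expand2 u v w P + expand2 v w u P + expand2 w u v P) \<in> tree_ideal G {u, v, w}"
proof -
  define X where "X P = expand2 u v w P + expand2 v w u P + expand2 w u v P" for P
  define J where "J = {P \<in> fcarr G {u, v, w}. P - X P \<in> tree_ideal G {u, v, w}}"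
  have X: "X (P + Q) = X P + X Q" "X (scl c P) = scl c (X P)" for P Q c
    by (simp_all add: X_def expand2_simps scl_left_simps)
  have fin: "finite {u, v, w}"
    by simp
  have "is_subspace (obj (formal_operad G) {u, v, w}) J"
    unfolding is_subspace_def formal_ops
  proof (intro conjI ballI allI)
    show "0 \<in> J"
      using X(2)[of 0 0] tree_ideal_zero[OF fin] by (simp add: J_def)
    show "scl c P \<in> J" if "P \<in> J" for c P
    proof -
      have "scl c P - scl c (X P) = scl c (P - X P)"
        by (rule lin_eqI) (simp add: lin_simps algebra_simps)
      then show ?thesis
        using that by (simp add: J_def X fcarr_scl tree_ideal_scl)
    qed
    show "P + Q \<in> J" if "P \<in> J" "Q \<in> J" for P Q
    proof -
      have "P - X P + (Q - X Q) \<in> tree_ideal G {u, v, w}"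
        using that tree_ideal_add[OF fin] by (simp add: J_def)
      then show ?thesis
        using that by (simp add: J_def X fcarr_add algebra_simps)
    qed
  qed (auto simp: J_def)
  moreover have "tree_ideal G {u, v, w} \<subseteq> J"
    using tree_ideal_fcarr by (auto simp: J_def X_def expand2_def coord2_tree_ideal[of _ "{u, v, w}"])
  moreover have "gen2 p q x y z \<in> J" if "(x, y, z) \<in> cyc u v w" for p q x y z
  proof -
    note * = cyc_distinct[OF V(1) that]
    have s: "{v, w, u} = {u, v, w}" "{w, u, v} = {u, v, w}"
      by auto
    have "X (gen2 p q x y z) = gen2 p q x y z"
      using that V * s unfolding cyc_def
      by (cases p; cases q) (auto simp: X_def expand2_def coord2_gen2 scl_left_simps)
    then show ?thesis
      using gen2_fcarr[of x y z p q] * tree_ideal_zero[OF fin] by (simp add: J_def)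
  qed
  ultimately have "P \<in> J"
    using two_node_induct[OF V(1), of J P] P by (auto simp: two_nodes_def)
  then show ?thesis
    by (simp add: J_def X_def)
qed

lemma two_nodes_coord2_eq:
  assumes V: "distinct [u, v, w]" and "P \<in> two_nodes G {u, v, w}" "Q \<in> two_nodes G {u, v, w}"
    and eq: "\<And>p q x y z. (x, y, z) \<in> cyc u v w \<Longrightarrow> coord2 p q x y z P = coord2 p q x y z Q"
  shows "cls G {u, v, w} P = cls G {u, v, w} Q"
proof -
  have "expand2 x y z (P - Q) = 0" if "(x, y, z) \<in> cyc u v w" for x y z
    using eq[OF that] by (simp add: expand2_def coord2_simps)
  then have "P - Q \<in> tree_ideal G {u, v, w}"
    using two_nodes_expand[OF V two_nodes_diff[OF assms(2,3)]] by (simp add: cyc_def)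
  then show ?thesis
    by (simp add: cls_eq_iff)
qed

text \<open>A sub-species is closed under relabelling and coordinates are natural. So one element at
  \<open>{a, b, c}\<close> yields an element with the same coordinate table at every ordered triple,
  also at permutations of \<open>a\<close>, \<open>b\<close>, \<open>c\<close>.\<close>

lemma coord2_transport:
  assumes I: "subspecies (free_operad G) I" and P: "P \<in> two_nodes G {a, b, c}" "cls G {a, b, c} P \<in> I {a, b, c}"
    and d: "distinct [a, b, c]" "distinct [x, y, z]" "{x, y, z} = V"
  obtains Q where "Q \<in> two_nodes G V" "cls G V Q \<in> I V" "\<And>p q. coord2 p q x y z Q = coord2 p q a b c P"
    "\<And>p q. coord2 p q y z x Q = coord2 p q b c a P" "\<And>p q. coord2 p q z x y Q = coord2 p q c a b P"
proof -
  define \<sigma> where "\<sigma> l = (if l = a then x else if l = b then y else z)" for l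
  have \<sigma>: "\<sigma> a = x" "\<sigma> b = y" "\<sigma> c = z" "inj_on \<sigma> {a, b, c}" "\<sigma> ` {a, b, c} = V"
    using d by (auto simp: \<sigma>_def)
  define Q where "Q = factn G {a, b, c} \<sigma> P"
  show ?thesis
  proof (rule that)
    show "Q \<in> two_nodes G V"
      using factn_two_nodes[OF \<sigma>(4) P(1)] \<sigma> by (simp add: Q_def)
    show "cls G V Q \<in> I V"
      using subspecies_act[OF I _ \<sigma>(4) P(2)] free_act[OF _ \<sigma>(4)] unfolding \<sigma> by (simp add: Q_def)
    have *: "coord2 p q (\<sigma> r) (\<sigma> s) (\<sigma> t) Q = coord2 p q r s t P" if "{r, s, t} \<subseteq> {a, b, c}" for p q r s t
      unfolding Q_def by (rule coord2_factn[OF \<sigma>(4) that two_nodes_fcarr[OF P(1)]])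
    show "coord2 p q x y z Q = coord2 p q a b c P" "coord2 p q y z x Q = coord2 p q b c a P"
      "coord2 p q z x y Q = coord2 p q c a b P" for p q
      using *[of a b c p q] *[of b c a p q] *[of c a b p q] unfolding \<sigma> by auto
  qed
qed

end

section \<open>The generators of SP and of its Koszul dual\<close>

lemma seq_sign_2: "seq_sign [x, y] = (if y < x then - 1 else 1)"
  by (simp add: seq_sign_def)

lemma seq_sign_swap: "x \<noteq> y \<Longrightarrow> seq_sign [y, x] = - seq_sign [x, y]"
  by (auto simp: seq_sign_2)

lemma seq_sign_square: "seq_sign xs * seq_sign xs = 1" "seq_sign xs * (seq_sign xs * c) = c"
  unfolding seq_sign_def by (simp_all flip: power_add mult.assoc)

lemma seq_sign_3: "seq_sign [x, y, z] = seq_sign [x, y] * seq_sign [x, z] * seq_sign [y, z]"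
  by (simp add: seq_sign_def)

text \<open>By \<open>seq_sign_3\<close> the sign is a product over pairs, so a permutation changes
  it once for each pair whose order it reverses.\<close>

lemma seq_sign_permute:
  assumes "distinct [x, y, z]"
  shows "seq_sign [y, z, x] = seq_sign [x, y, z]" "seq_sign [z, x, y] = seq_sign [x, y, z]"
    "seq_sign [x, z, y] = - seq_sign [x, y, z]" "seq_sign [y, x, z] = - seq_sign [x, y, z]"
    "seq_sign [z, y, x] = - seq_sign [x, y, z]"
  using assms by (simp_all add: seq_sign_3 seq_sign_swap[of x y] seq_sign_swap[of x z] seq_sign_swap[of y z])

lemma sorted_list_of_pair: "x < y \<Longrightarrow> sorted_list_of_set {x, y} = [x, y]"
  by (rule sorted_distinct_set_unique) auto

text \<open>The signature is the quotient of two orientations. This form treats \<open>x < y\<close>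
  and \<open>y < x\<close> alike and cancels against the signs of generators and
  coordinates.\<close>

lemma bij_sign_pair:
  assumes "x \<noteq> y" "inj_on \<sigma> {x, y}"
  shows "bij_sign {x, y} \<sigma> = seq_sign [x, y] * seq_sign [\<sigma> x, \<sigma> y]"
proof -
  have "\<sigma> x \<noteq> \<sigma> y"
    using assms by auto
  with \<open>x \<noteq> y\<close> show ?thesis
    by (cases x y rule: linorder_cases)
      (auto simp: bij_sign_def sorted_list_of_pair seq_sign_2 insert_commute[of x])
qed

abbreviation SP_dual :: "('l::{linorder,infinite}, 'k::field_char_0, (sp_gen \<Rightarrow> 'k) \<Rightarrow> 'k) species" where
  "SP_dual \<equiv> dual_species SP_species"

definition unit_vec :: "sp_gen \<Rightarrow> sp_gen \<Rightarrow> 'k::field_char_0" where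
  "unit_vec p = (\<lambda>q. if q = p then 1 else 0)"

lemma SP_obj [simp]:
  "x \<noteq> y \<Longrightarrow> carr (obj SP_species {x, y}) = UNIV"
  "vadd (obj SP_species V) = (\<lambda>f g p. f p + g p)"
  "vscale (obj SP_species V) = (\<lambda>c f p. c * f p)"
  "act SP_species V \<sigma> f = f"
  by (simp_all add: SP_species_def)

lemma SP_dual_carr:
  assumes "x \<noteq> y"
  shows "F \<in> carr (obj SP_dual {x, y}) \<longleftrightarrow>
    (\<forall>f g. F (\<lambda>p. f p + g p) = F f + F g) \<and> (\<forall>c f. F (\<lambda>p. c * f p) = c * F f)"
  using assms by (simp add: dual_species_def dual_space_def linear_map_def base_space_def)

lemma SP_dual_obj [simp]:
  "vadd (obj SP_dual V) = (\<lambda>f g x. f x + g x)"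
  "vscale (obj SP_dual V) = (\<lambda>c f x. c * f x)"
  by (simp_all add: dual_species_def dual_space_def)

lemma SP_dual_act:
  assumes "x \<noteq> y" "inj_on \<sigma> {x, y}"
  shows "act SP_dual {x, y} \<sigma> F = (\<lambda>g. seq_sign [x, y] * seq_sign [\<sigma> x, \<sigma> y] * F g)"
proof -
  have "\<sigma> x \<noteq> \<sigma> y"
    using assms by auto
  then show ?thesis
    using assms by (simp add: dual_species_def bij_sign_pair)
qed

lemma SP_dual_expand:
  assumes "x \<noteq> y" "F \<in> carr (obj SP_dual {x, y})"
  shows "F g = g Mu * F (unit_vec Mu) + g Seg * F (unit_vec Seg)"
proof -
  have "g = (\<lambda>p. g Mu * unit_vec Mu p + g Seg * unit_vec Seg p)"
  proof
    show "g p = g Mu * unit_vec Mu p + g Seg * unit_vec Seg p" for p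
      by (cases p) (simp_all add: unit_vec_def)
  qed
  then have "F g = F (\<lambda>p. g Mu * unit_vec Mu p + g Seg * unit_vec Seg p)"
    by simp
  also have "\<dots> = g Mu * F (unit_vec Mu) + g Seg * F (unit_vec Seg)"
    using assms by (simp add: SP_dual_carr)
  finally show ?thesis .
qed

lemma SP_dual_gen_carr: "x \<noteq> y \<Longrightarrow> SP_dual_gen p x y \<in> carr (obj SP_dual {x, y})"
  by (simp add: SP_dual_carr SP_dual_gen_def algebra_simps)

text \<open>The orientation sign already present in \<open>SP_dual_gen\<close> is repeated so that
  the coordinate of a generator is the square of a sign, hence 1.\<close>

definition SP_dual_coord :: "((sp_gen \<Rightarrow> 'k) \<Rightarrow> 'k) \<Rightarrow> 'l::linorder \<Rightarrow> 'l \<Rightarrow> sp_gen \<Rightarrow> 'k::field_char_0" where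
  "SP_dual_coord F x y p = seq_sign [x, y] * F (unit_vec p)"

lemma SP_dual_gen_unit_vec: "SP_dual_gen p x y (unit_vec q) = (if p = q then seq_sign [x, y] else 0)"
  by (simp add: SP_dual_gen_def unit_vec_def)

lemma SP_dual_gen_expand:
  assumes "x \<noteq> y" "F \<in> carr (obj SP_dual {x, y})"
  shows "F = (\<lambda>g. SP_dual_coord F x y Mu * SP_dual_gen Mu x y g + SP_dual_coord F x y Seg * SP_dual_gen Seg x y g)"
proof
  show "F g = SP_dual_coord F x y Mu * SP_dual_gen Mu x y g + SP_dual_coord F x y Seg * SP_dual_gen Seg x y g" for g
    using SP_dual_expand[OF assms, of g] by (simp add: SP_dual_coord_def SP_dual_gen_def seq_sign_2)
qed

interpretation SP: binary_generators
  "SP_species :: ('l::{linorder,infinite}, 'k::field_char_0, sp_gen \<Rightarrow> 'k) species"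
  SP_gen "\<lambda>f x y. f" 1
proof unfold_locales
  fix x y :: 'l and f :: "sp_gen \<Rightarrow> 'k" assume "x \<noteq> y"
  show "f = vadd (obj SP_species {x, y}) (vscale (obj SP_species {x, y}) (f Mu) (SP_gen Mu x y))
      (vscale (obj SP_species {x, y}) (f Seg) (SP_gen Seg x y))"
  proof
    show "f p = vadd (obj SP_species {x, y}) (vscale (obj SP_species {x, y}) (f Mu) (SP_gen Mu x y))
      (vscale (obj SP_species {x, y}) (f Seg) (SP_gen Seg x y)) p" for p
      by (cases p) (simp_all add: SP_gen_def)
  qed
qed (auto simp: SP_gen_def inj_on_def)

text \<open>The twist of the action is the product of the orientation signs of \<open>(x, y)\<close>
  and of its image, and these cancel the signs in the two coordinates. Coordinates are therefore
  invariant under relabelling, and the twist survives only in \<epsilon> = -1.\<close>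

interpretation SPd: binary_generators
  "SP_dual :: ('l::{linorder,infinite}, 'k::field_char_0, (sp_gen \<Rightarrow> 'k) \<Rightarrow> 'k) species"
  SP_dual_gen SP_dual_coord "- 1"
proof unfold_locales
  fix x y :: 'l and f g :: "(sp_gen \<Rightarrow> 'k) \<Rightarrow> 'k" and c :: 'k and \<sigma> :: "'l \<Rightarrow> 'l" and p
  assume xy: "x \<noteq> y"
  show "SP_dual_gen p x y \<in> carr (obj SP_dual {x, y})"
    by (rule SP_dual_gen_carr[OF xy])
  show "SP_dual_coord (SP_dual_gen p x y) x y q = (if p = q then 1 else 0 :: 'k)" for q
    by (simp add: SP_dual_coord_def SP_dual_gen_unit_vec seq_sign_square)
  assume f: "f \<in> carr (obj SP_dual {x, y})"
  show "vscale (obj SP_dual {x, y}) c f \<in> carr (obj SP_dual {x, y})"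
    using f xy by (simp add: SP_dual_carr algebra_simps)
  show "SP_dual_coord (vscale (obj SP_dual {x, y}) c f) x y p = c * SP_dual_coord f x y p"
    by (simp add: SP_dual_coord_def)
  show "SP_dual_coord f y x p = - 1 * SP_dual_coord f x y p"
    by (simp add: SP_dual_coord_def seq_sign_swap[OF xy])
  show "f = vadd (obj SP_dual {x, y}) (vscale (obj SP_dual {x, y}) (SP_dual_coord f x y Mu) (SP_dual_gen Mu x y))
      (vscale (obj SP_dual {x, y}) (SP_dual_coord f x y Seg) (SP_dual_gen Seg x y))"
    unfolding SP_dual_obj by (rule SP_dual_gen_expand[OF xy f])
  show "vadd (obj SP_dual {x, y}) f g \<in> carr (obj SP_dual {x, y})"
    "SP_dual_coord (vadd (obj SP_dual {x, y}) f g) x y p = SP_dual_coord f x y p + SP_dual_coord g x y p"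
    if "g \<in> carr (obj SP_dual {x, y})"
    using f that xy by (simp_all add: SP_dual_carr SP_dual_coord_def algebra_simps)
  assume \<sigma>: "inj_on \<sigma> {x, y}"
  then have "\<sigma> x \<noteq> \<sigma> y"
    using xy by auto
  then show "act SP_dual {x, y} \<sigma> f \<in> carr (obj SP_dual {\<sigma> x, \<sigma> y})"
    using f xy \<sigma> by (simp add: SP_dual_carr SP_dual_act algebra_simps)
  show "SP_dual_coord (act SP_dual {x, y} \<sigma> f) (\<sigma> x) (\<sigma> y) p = SP_dual_coord f x y p"
    using xy \<sigma> by (simp add: SP_dual_act SP_dual_coord_def seq_sign_square ac_simps)
qed simp

lemma antisymmetric_generators:
  "has_two_antisymmetric_generators
    (SP_dual :: ('l::{linorder,infinite}, 'k::field_char_0, (sp_gen \<Rightarrow> 'k) \<Rightarrow> 'k) species)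
    (SP_dual_gen Mu) (SP_dual_gen Seg)"
  unfolding has_two_antisymmetric_generators_def
proof (intro conjI allI impI ballI)
  fix V :: "'l set" assume V: "finite V \<and> card V \<noteq> 2"
  have "F = (\<lambda>_. 0)" if "F \<in> carr (obj SP_dual V)" for F :: "(sp_gen \<Rightarrow> 'k) \<Rightarrow> 'k"
  proof
    fix g :: "sp_gen \<Rightarrow> 'k"
    \<comment> \<open>Homogeneity at the zero vector, the only element of the carrier; elsewhere
      \<open>F\<close> vanishes by the convention of \<open>dual_space\<close>.\<close>
    have "F (\<lambda>p. 0 * 0) = 0 * F (\<lambda>p. 0)"
      using that unfolding dual_species_def dual_space_def linear_map_def base_space_def SP_species_def by auto
    then show "F g = 0"
      using that V by (cases "g = (\<lambda>_. 0)") (auto simp: dual_species_def dual_space_def SP_species_def)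
  qed
  moreover have "(\<lambda>_. 0) \<in> carr (obj SP_dual V)"
    by (simp add: dual_species_def dual_space_def linear_map_def base_space_def)
  ultimately show "carr (obj SP_dual V) = {vzero (obj SP_dual V :: ('k, (sp_gen \<Rightarrow> 'k) \<Rightarrow> 'k) vspace)}"
    by (auto simp: dual_species_def dual_space_def)
next
  fix x y :: 'l and r :: "'l \<Rightarrow> 'l \<Rightarrow> (sp_gen \<Rightarrow> 'k) \<Rightarrow> 'k"
  assume xy: "x \<noteq> y" and "r \<in> {SP_dual_gen Mu, SP_dual_gen Seg}"
  then obtain p where r: "r = SP_dual_gen p"
    by auto
  show "r x y \<in> carr (obj SP_dual {x, y})"
    unfolding r by (rule SP_dual_gen_carr[OF xy])
  show "r y x = vscale (obj SP_dual {x, y}) (- 1) (r x y)"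
    by (simp add: r SP_dual_gen_def seq_sign_swap[OF xy])
  show "act SP_dual {x, y} \<sigma> (r x y) = r (\<sigma> x) (\<sigma> y)" if "inj_on \<sigma> {x, y}" for \<sigma>
    using xy that by (simp add: r SP_dual_act SP_dual_gen_def seq_sign_square ac_simps)
next
  fix x y :: 'l and f :: "(sp_gen \<Rightarrow> 'k) \<Rightarrow> 'k"
  assume xy: "x \<noteq> y" and f: "f \<in> carr (obj SP_dual {x, y})"
  show "\<exists>!cd. f = vadd (obj SP_dual {x, y}) (vscale (obj SP_dual {x, y}) (fst cd) (SP_dual_gen Mu x y))
      (vscale (obj SP_dual {x, y}) (snd cd) (SP_dual_gen Seg x y))"
  proof (rule ex1I[of _ "(SP_dual_coord f x y Mu, SP_dual_coord f x y Seg)"])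
    show "cd = (SP_dual_coord f x y Mu, SP_dual_coord f x y Seg)"
      if "f = vadd (obj SP_dual {x, y}) (vscale (obj SP_dual {x, y}) (fst cd) (SP_dual_gen Mu x y))
      (vscale (obj SP_dual {x, y}) (snd cd) (SP_dual_gen Seg x y))" for cd
      \<comment> \<open>Applying the coordinate functionals to the assumed expansion of
        \<open>f\<close> returns its two coefficients.\<close>
      using xy by (subst (1 2) that)
        (simp add: SP_dual_coord_def SP_dual_gen_unit_vec seq_sign_square ac_simps prod_eq_iff)
  qed (simp only: SP_dual_obj fst_conv snd_conv, rule SP_dual_gen_expand[OF xy f])
qed

section \<open>The natural pairing\<close>

definition pair_row ::
  "'l::{linorder,infinite} \<Rightarrow> 'l \<Rightarrow> 'l \<Rightarrow> ('l, 'k, (sp_gen \<Rightarrow> 'k) \<Rightarrow> 'k) tree_sum \<Rightarrow>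
    ('l, 'k, sp_gen \<Rightarrow> 'k) tree_sum \<Rightarrow> 'k::field_char_0" where
  "pair_row x y z P Q =
     SPd.coord2 Mu Mu x y z P * SP.coord2 Mu Mu x y z Q +
     SPd.coord2 Mu Seg x y z P * SP.coord2 Mu Seg x y z Q +
     SPd.coord2 Seg Mu x y z P * SP.coord2 Seg Mu x y z Q +
     SPd.coord2 Seg Seg x y z P * SP.coord2 Seg Seg x y z Q"

text \<open>The sign removes the dependence on the cyclic class: passing to the opposite class
  negates the dual coordinates of two-node sums, keeps those on the side of SP, and negates
  \<open>seq_sign [u, v, w]\<close>.\<close>

definition sum_pairing ::
  "'l::{linorder,infinite} \<Rightarrow> 'l \<Rightarrow> 'l \<Rightarrow> ('l, 'k, (sp_gen \<Rightarrow> 'k) \<Rightarrow> 'k) tree_sum \<Rightarrow>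
    ('l, 'k, sp_gen \<Rightarrow> 'k) tree_sum \<Rightarrow> 'k::field_char_0" where
  "sum_pairing u v w P Q = seq_sign [u, v, w] * (pair_row u v w P Q + pair_row v w u P Q + pair_row w u v P Q)"

lemma sum_pairing_simps:
  "sum_pairing u v w (P + P') Q = sum_pairing u v w P Q + sum_pairing u v w P' Q"
  "sum_pairing u v w (P - P') Q = sum_pairing u v w P Q - sum_pairing u v w P' Q"
  "sum_pairing u v w (scl c P) Q = c * sum_pairing u v w P Q"
  "sum_pairing u v w P (Q + Q') = sum_pairing u v w P Q + sum_pairing u v w P Q'"
  "sum_pairing u v w P (Q - Q') = sum_pairing u v w P Q - sum_pairing u v w P Q'"
  "sum_pairing u v w P (scl c Q) = c * sum_pairing u v w P Q"
  by (simp_all add: sum_pairing_def pair_row_def SPd.coord2_simps SP.coord2_simps algebra_simps)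

lemma sum_pairing_tree_ideal:
  assumes "P' - P \<in> tree_ideal SP_dual V" "Q' - Q \<in> tree_ideal SP_species V"
  shows "sum_pairing u v w P' Q' = sum_pairing u v w P Q"
proof -
  have "sum_pairing u v w (P' - P) Q' = 0" "sum_pairing u v w P (Q' - Q) = 0"
    using SPd.coord2_tree_ideal[OF assms(1)] SP.coord2_tree_ideal[OF assms(2)]
    by (simp_all add: sum_pairing_def pair_row_def)
  then show ?thesis
    by (simp add: sum_pairing_simps)
qed

text \<open>Expanding \<open>f1 g1\<close> and \<open>f2 g2\<close> over the two generators gives
  exactly the four products of coordinates in a row. The sign -1 arises on the antisymmetric side
  only.\<close>

lemma pair_row_tree2:
  assumes d: "distinct [X, Y, Z]" "distinct [x, y, z]" "distinct [x', y', z']"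
    and s: "{X, Y, Z} = {x, y, z}" "{X, Y, Z} = {x', y', z'}"
    and "x \<noteq> a" and f: "f1 \<in> carr (obj SP_dual {x, a})" "f2 \<in> carr (obj SP_dual {y, z})"
  shows "pair_row X Y Z (tree_elt (tree2 f1 f2 a x y z)) (tree_elt (tree2 g1 g2 a x' y' z')) =
    (if x = X \<and> x' = X then (seq_sign [x, a] * f1 g1) * (seq_sign [y, z] * f2 g2) * (if y = Y then 1 else - 1) else 0)"
proof -
  have e: "f1 g1 = g1 Mu * f1 (unit_vec Mu) + g1 Seg * f1 (unit_vec Seg)"
    "f2 g2 = g2 Mu * f2 (unit_vec Mu) + g2 Seg * f2 (unit_vec Seg)"
    using d by (intro SP_dual_expand[OF \<open>x \<noteq> a\<close> f(1)] SP_dual_expand[OF _ f(2)], simp)+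
  show ?thesis
    unfolding pair_row_def SPd.coord2_tree2[OF d(2) d(1) s(1)] SP.coord2_tree2[OF d(3) d(1) s(2)]
      SP_dual_coord_def e
    by (simp add: algebra_simps)
qed

text \<open>At most the row of the common root leaf survives. Its sign, +1 or -1 as
  \<open>(x, y, z)\<close> is or is not a rotation of \<open>(u, v, w)\<close>, turns
  \<open>seq_sign [u, v, w]\<close> into \<open>seq_sign [x, y, z]\<close>.\<close>

lemma sum_pairing_tree2:
  assumes d: "distinct [u, v, w]" "distinct [x, y, z]" "distinct [x', y', z']"
    and s: "{x, y, z} = {u, v, w}" "{x', y', z'} = {u, v, w}"
    and a: "x \<noteq> a" and f: "f1 \<in> carr (obj SP_dual {x, a})" "f2 \<in> carr (obj SP_dual {y, z})"
  shows "sum_pairing u v w (tree_elt (tree2 f1 f2 a x y z)) (tree_elt (tree2 g1 g2 a x' y' z')) =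
    (if x = x' then seq_sign [x, y, z] * (seq_sign [x, a] * f1 g1) * (seq_sign [y, z] * f2 g2) else 0)"
proof -
  define c where "c = (seq_sign [x, a] * f1 g1) * (seq_sign [y, z] * f2 g2)"
  have row: "pair_row X Y Z (tree_elt (tree2 f1 f2 a x y z)) (tree_elt (tree2 g1 g2 a x' y' z')) =
      (if x = X \<and> x' = X then c * (if y = Y then 1 else - 1) else 0)"
    if "distinct [X, Y, Z]" "{X, Y, Z} = {u, v, w}" for X Y Z
    unfolding c_def using that s by (intro pair_row_tree2[OF that(1) d(2,3) _ _ a f]) simp_all
  have "distinct [v, w, u]" "distinct [w, u, v]" "{v, w, u} = {u, v, w}" "{w, u, v} = {u, v, w}"
    using d by auto
  note rows = row[OF d(1) refl] row[OF this(1,3)] row[OF this(2,4)]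
  have sgn: "seq_sign [v, w, u] = (seq_sign [u, v, w] :: 'b)" "seq_sign [w, u, v] = (seq_sign [u, v, w] :: 'b)"
    "seq_sign [u, w, v] = - (seq_sign [u, v, w] :: 'b)" "seq_sign [v, u, w] = - (seq_sign [u, v, w] :: 'b)"
    "seq_sign [w, v, u] = - (seq_sign [u, v, w] :: 'b)"
    by (rule seq_sign_permute[OF d(1)])+
  have mem: "x \<in> {u, v, w}" "y \<in> {u, v, w}" "z \<in> {u, v, w}"
    using s by blast+
  have "seq_sign [u, v, w] * ((if x = u \<and> x' = u then c * (if y = v then 1 else - 1) else 0) +
      (if x = v \<and> x' = v then c * (if y = w then 1 else - 1) else 0) +
      (if x = w \<and> x' = w then c * (if y = u then 1 else - 1) else 0)) =
    (if x = x' then seq_sign [x, y, z] * c else 0)"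
  proof (cases "x = x'")
    case True
    consider "x = u" "y = v" "z = w" | "x = u" "y = w" "z = v" | "x = v" "y = w" "z = u" |
      "x = v" "y = u" "z = w" | "x = w" "y = u" "z = v" | "x = w" "y = v" "z = u"
      using mem d(2) by (elim insertE emptyE) simp_all
    moreover have ne: "u \<noteq> v" "v \<noteq> u" "u \<noteq> w" "w \<noteq> u" "v \<noteq> w" "w \<noteq> v"
      using d(1) by auto
    ultimately show ?thesis
      unfolding True[symmetric] by cases (simp_all add: sgn ne)
  next
    case False
    then have *: "x = t \<and> x' = t \<longleftrightarrow> False" for t
      by blast
    show ?thesis
      unfolding * using False by simp
  qed
  then show ?thesis
    unfolding sum_pairing_def rows by (simp add: c_def mult.assoc)
qed

section \<open>The pairing on classes and its uniqueness\<close>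

definition rep :: "'a set \<Rightarrow> 'a" where
  "rep A = (SOME p. p \<in> A)"

lemma (in vector_species) rep_cls: "finite V \<Longrightarrow> rep (cls G V P) - P \<in> tree_ideal G V"
  using someI[of "\<lambda>p. p \<in> cls G V P", OF cls_self] by (simp add: rep_def cls_iff)

text \<open>The representative picked by \<open>rep\<close> may contain other trees, but
  \<open>sum_pairing\<close> depends only on the class. The value 0 off the carriers is demanded by
  \<open>bilinear_form\<close>, which lets natural pairings agree as total functions.\<close>

definition SP_form ::
  "'l::{linorder,infinite} \<Rightarrow> 'l \<Rightarrow> 'l \<Rightarrow> ('l, 'k, (sp_gen \<Rightarrow> 'k) \<Rightarrow> 'k) free_elt \<Rightarrow>
    ('l, 'k, sp_gen \<Rightarrow> 'k) free_elt \<Rightarrow> 'k::field_char_0" where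
  "SP_form u v w f g =
     (if f \<in> carr (free_two SP_dual {u, v, w}) \<and> g \<in> carr (free_two SP_species {u, v, w})
      then sum_pairing u v w (rep f) (rep g) else 0)"

lemma SP_form_cls:
  assumes "P \<in> two_nodes SP_dual {u, v, w}" "Q \<in> two_nodes SP_species {u, v, w}"
  shows "SP_form u v w (cls SP_dual {u, v, w} P) (cls SP_species {u, v, w} Q) = sum_pairing u v w P Q"
proof -
  have "sum_pairing u v w (rep (cls SP_dual {u, v, w} P)) (rep (cls SP_species {u, v, w} Q)) = sum_pairing u v w P Q"
    by (intro sum_pairing_tree_ideal[of _ _ "{u, v, w}"] SPd.rep_cls SP.rep_cls) auto
  then show ?thesis
    using assms by (auto simp: SP_form_def carr_free_two)
qed

lemma bilinear_formI:
  assumes "\<And>f g. f \<notin> carr M \<or> g \<notin> carr N \<Longrightarrow> B f g = 0"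
    and "\<And>f f' g. f \<in> carr M \<Longrightarrow> f' \<in> carr M \<Longrightarrow> g \<in> carr N \<Longrightarrow> B (vadd M f f') g = B f g + B f' g"
    and "\<And>c f g. f \<in> carr M \<Longrightarrow> g \<in> carr N \<Longrightarrow> B (vscale M c f) g = c * B f g"
    and "\<And>f g g'. f \<in> carr M \<Longrightarrow> g \<in> carr N \<Longrightarrow> g' \<in> carr N \<Longrightarrow> B f (vadd N g g') = B f g + B f g'"
    and "\<And>c f g. f \<in> carr M \<Longrightarrow> g \<in> carr N \<Longrightarrow> B f (vscale N c g) = c * B f g"
  shows "bilinear_form M N B"
  unfolding bilinear_form_def dual_space_def linear_map_def base_space_def using assms by simp

lemma bilinear_SP_form:
  "bilinear_form (free_two SP_dual {u, v, w})
    (free_two (SP_species :: ('l::{linorder,infinite}, 'k::field_char_0, sp_gen \<Rightarrow> 'k) species) {u, v, w})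
    (SP_form u v w)"
proof (rule bilinear_formI)
  let ?V = "{u, v, w}" and ?G = "SP_species :: ('l, 'k, sp_gen \<Rightarrow> 'k) species"
    and ?D = "SP_dual :: ('l, 'k, (sp_gen \<Rightarrow> 'k) \<Rightarrow> 'k) species"
  fix f f' g g' and c :: 'k
  show "SP_form u v w f g = 0" if "f \<notin> carr (free_two ?D ?V) \<or> g \<notin> carr (free_two ?G ?V)"
    using that by (auto simp: SP_form_def)
  assume "f \<in> carr (free_two ?D ?V)" "g \<in> carr (free_two ?G ?V)"
  then obtain P Q where PQ: "P \<in> two_nodes ?D ?V" "f = cls ?D ?V P" "Q \<in> two_nodes ?G ?V" "g = cls ?G ?V Q"
    by (auto simp: carr_free_two)
  show "SP_form u v w (vscale (free_two ?D ?V) c f) g = c * SP_form u v w f g"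
    using PQ by (simp add: free_two_scale SPd.free_scale SP_form_cls two_nodes_scl sum_pairing_simps)
  show "SP_form u v w f (vscale (free_two ?G ?V) c g) = c * SP_form u v w f g"
    using PQ by (simp add: free_two_scale SP.free_scale SP_form_cls two_nodes_scl sum_pairing_simps)
  show "SP_form u v w (vadd (free_two ?D ?V) f f') g = SP_form u v w f g + SP_form u v w f' g"
    if f': "f' \<in> carr (free_two ?D ?V)"
  proof -
    obtain P' where "P' \<in> two_nodes ?D ?V" "f' = cls ?D ?V P'"
      using f' by (auto simp: carr_free_two)
    then show ?thesis
      using PQ by (simp add: free_two_add SPd.free_add SP_form_cls two_nodes_add sum_pairing_simps)
  qed
  show "SP_form u v w f (vadd (free_two ?G ?V) g g') = SP_form u v w f g + SP_form u v w f g'"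
    if g': "g' \<in> carr (free_two ?G ?V)"
  proof -
    obtain Q' where "Q' \<in> two_nodes ?G ?V" "g' = cls ?G ?V Q'"
      using g' by (auto simp: carr_free_two)
    then show ?thesis
      using PQ by (simp add: free_two_add SP.free_add SP_form_cls two_nodes_add sum_pairing_simps)
  qed
qed

lemma natural_SP_form:
  fixes u v w :: "'l::{linorder,infinite}"
  assumes d: "distinct [u, v, w]"
  shows "is_natural_pairing (SP_species :: ('l, 'k::field_char_0, sp_gen \<Rightarrow> 'k) species) {u, v, w} (SP_form u v w)"
  unfolding is_natural_pairing_def
proof (intro conjI allI impI bilinear_SP_form)
  fix a x y z x' y' z' and f1 f2 :: "(sp_gen \<Rightarrow> 'k) \<Rightarrow> 'k" and g1 g2 :: "sp_gen \<Rightarrow> 'k"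
  let ?V = "{u, v, w}"
  assume *: "a \<notin> ?V \<and> distinct [x, y, z] \<and> {x, y, z} = ?V \<and> distinct [x', y', z'] \<and> {x', y', z'} = ?V \<and>
    f1 \<in> carr (obj SP_dual {x, a}) \<and> f2 \<in> carr (obj SP_dual {y, z}) \<and>
    g1 \<in> carr (obj SP_species {x', a}) \<and> g2 \<in> carr (obj SP_species {y', z'})"
  then have xa: "x \<noteq> a" "x' \<noteq> a" "a \<notin> {x, y, z}" "a \<notin> {x', y', z'}"
    by auto
  have P: "tree_elt (tree2 f1 f2 a x y z) \<in> two_nodes SP_dual {x, y, z}"
    and Q: "tree_elt (tree2 g1 g2 a x' y' z') \<in> two_nodes SP_species {x', y', z'}"
    using * xa by (auto simp: two_nodes_def fcarr_iff tree2_def)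
  have f: "pcomp (free_operad SP_dual) {x} {y, z} a (free_generator SP_dual f1 x a) (free_generator SP_dual f2 y z) =
      cls SP_dual ?V (tree_elt (tree2 f1 f2 a x y z))"
    using SPd.pcomp_free_generator[of x y z a f1 f2] * xa by metis
  have g: "pcomp (free_operad SP_species) {x'} {y', z'} a (free_generator SP_species g1 x' a)
      (free_generator SP_species g2 y' z') = cls SP_species ?V (tree_elt (tree2 g1 g2 a x' y' z'))"
    using SP.pcomp_free_generator[of x' y' z' a g1 g2] * xa by metis
  show "SP_form u v w
      (pcomp (free_operad SP_dual) {x} {y, z} a (free_generator SP_dual f1 x a) (free_generator SP_dual f2 y z))
      (pcomp (free_operad SP_species) {x'} {y', z'} a (free_generator SP_species g1 x' a)
        (free_generator SP_species g2 y' z')) =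
    (if x = x' then seq_sign [x, y, z] * (seq_sign [x, a] * f1 g1) * (seq_sign [y, z] * f2 g2) else 0)"
    unfolding f g using P Q * xa by (simp only: SP_form_cls sum_pairing_tree2[OF d])
qed

lemma natural_pairingD:
  assumes "is_natural_pairing G V B" "a \<notin> V" "distinct [x, y, z]" "{x, y, z} = V"
    "distinct [x', y', z']" "{x', y', z'} = V" "f1 \<in> carr (obj (dual_species G) {x, a})"
    "f2 \<in> carr (obj (dual_species G) {y, z})" "g1 \<in> carr (obj G {x', a})" "g2 \<in> carr (obj G {y', z'})"
  shows "B (pcomp (free_operad (dual_species G)) {x} {y, z} a
      (free_generator (dual_species G) f1 x a) (free_generator (dual_species G) f2 y z))
    (pcomp (free_operad G) {x'} {y', z'} a (free_generator G g1 x' a) (free_generator G g2 y' z')) =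
    (if x = x' then seq_sign [x, y, z] * (seq_sign [x, a] * f1 g1) * (seq_sign [y, z] * f2 g2) else 0)"
  using assms unfolding is_natural_pairing_def by blast

text \<open>Both arguments are spanned by generators, where the values are prescribed.
  \<open>two_nodes_linear_eq\<close> is applied to the second argument for a fixed generator in the
  first, and then to the first.\<close>

lemma natural_pairing_unique:
  assumes d: "distinct [u, v, w]"
    and B: "is_natural_pairing (SP_species :: ('l::{linorder,infinite}, 'k::field_char_0, sp_gen \<Rightarrow> 'k) species) {u, v, w} B"
      "is_natural_pairing SP_species {u, v, w} C"
  shows "B = C"
proof (intro ext)
  fix f g
  let ?V = "{u, v, w}"
  have bil: "bilinear_form (free_two SP_dual ?V) (free_two SP_species ?V) B"
    "bilinear_form (free_two SP_dual ?V) (free_two SP_species ?V) C"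
    using B by (auto simp: is_natural_pairing_def)
  have zero: "f \<notin> carr (free_two SP_dual ?V) \<or> g \<notin> carr (free_two SP_species ?V) \<Longrightarrow> B f g = C f g"
    using bil by (simp add: bilinear_form_def)
  have lin: "linear_map (free_two SP_species ?V) base_space (D f)"
    if "f \<in> carr (free_two SP_dual ?V)" "bilinear_form (free_two SP_dual ?V) (free_two SP_species ?V) D" for f D
    using that by (simp add: bilinear_form_def dual_space_def)
  have lin': "linear_map (free_two SP_dual ?V) base_space (\<lambda>f. D f g)"
    if "g \<in> carr (free_two SP_species ?V)" "bilinear_form (free_two SP_dual ?V) (free_two SP_species ?V) D" for g D
    using that by (simp add: bilinear_form_def dual_space_def)
  show "B f g = C f g"
  proof (cases "f \<in> carr (free_two SP_dual ?V) \<and> g \<in> carr (free_two SP_species ?V)")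
    case True
    have "B (cls SP_dual ?V (SPd.gen2 p q x y z)) g = C (cls SP_dual ?V (SPd.gen2 p q x y z)) g"
      if c: "(x, y, z) \<in> cyc u v w" for p q x y z
    proof (rule SP.two_nodes_linear_eq[OF d refl lin lin])
      note c = SPd.cyc_distinct[OF d c]
      show mem: "cls SP_dual ?V (SPd.gen2 p q x y z) \<in> carr (free_two SP_dual ?V)"
        using SPd.gen2_two_nodes[of x y z ?V p q] c by (auto simp: carr_free_two)
      then show "cls SP_dual ?V (SPd.gen2 p q x y z) \<in> carr (free_two SP_dual ?V)" .
      show "g \<in> carr (free_two SP_species ?V)"
        using True by simp
      fix p' q' x' y' z' assume "(x', y', z') \<in> cyc u v w"
      note c' = SPd.cyc_distinct[OF d this]
      \<comment> \<open>Both triples enumerate \<open>?V\<close>, so this single label is the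
        grafting point of both generators, as the evaluation formula requires.\<close>
      define a where "a = fresh ?V"
      have a: "a \<notin> ?V" "a \<notin> {x, y, z}" "a \<notin> {x', y', z'}" "x \<noteq> a" "x' \<noteq> a"
        using fresh_notin[of ?V] c c' by (auto simp: a_def)
      have P: "cls SP_dual ?V (SPd.gen2 p q x y z) =
          pcomp (free_operad SP_dual) {x} {y, z} a
            (free_generator SP_dual (SP_dual_gen p x a) x a) (free_generator SP_dual (SP_dual_gen q y z) y z)"
        using c a by (subst SPd.pcomp_free_generator) (auto simp: SPd.gen_closed SPd.gen2_def Let_def a_def)
      have Q: "cls SP_species ?V (SP.gen2 p' q' x' y' z') =
          pcomp (free_operad SP_species) {x'} {y', z'} a
            (free_generator SP_species (SP_gen p' x' a) x' a) (free_generator SP_species (SP_gen q' y' z') y' z')"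
        using c' a by (subst SP.pcomp_free_generator) (auto simp: SP.gen_closed SP.gen2_def Let_def a_def)
      have D: "D (cls SP_dual ?V (SPd.gen2 p q x y z)) (cls SP_species ?V (SP.gen2 p' q' x' y' z')) =
        (if x = x' then seq_sign [x, y, z] * (seq_sign [x, a] * SP_dual_gen p x a (SP_gen p' x' a)) *
          (seq_sign [y, z] * SP_dual_gen q y z (SP_gen q' y' z')) else 0)"
        if "is_natural_pairing SP_species ?V D" for D
        unfolding P Q using c c' a
        by (intro natural_pairingD[OF that]) (auto intro!: SPd.gen_closed SP.gen_closed)
      then show "B (cls SP_dual ?V (SPd.gen2 p q x y z)) (cls SP_species ?V (SP.gen2 p' q' x' y' z')) =
          C (cls SP_dual ?V (SPd.gen2 p q x y z)) (cls SP_species ?V (SP.gen2 p' q' x' y' z'))"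
        using D[OF B(1)] D[OF B(2)] by simp
    qed (rule bil)+
    then show ?thesis
      using True SPd.two_nodes_linear_eq[OF d refl lin'[OF _ bil(1)] lin'[OF _ bil(2)]] by simp
  qed (use zero in blast)
qed

lemma natural_pairing_eq:
  fixes u v w :: "'l::{linorder,infinite}"
  assumes "distinct [u, v, w]"
  shows "natural_pairing (SP_species :: ('l, 'k::field_char_0, sp_gen \<Rightarrow> 'k) species) {u, v, w} = SP_form u v w"
  unfolding natural_pairing_def
  by (intro the_equality natural_SP_form natural_pairing_unique[OF assms] assms)

section \<open>Orthogonal relations\<close>

lemma free_vsub:
  assumes "vector_species G" "finite V"
  shows "vsub (obj (free_operad G) V) (cls G V p) (cls G V q) = cls G V (p - q)"
proof -
  interpret vector_species G by fact
  show ?thesis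
    using assms(2) by (simp add: vsub_def free_add free_scale)
qed

definition assoc_rel :: "'l::{linorder,infinite} \<Rightarrow> 'l \<Rightarrow> 'l \<Rightarrow> ('l, 'k::field_char_0, sp_gen \<Rightarrow> 'k) tree_sum" where
  "assoc_rel a b c = SP.gen2 Mu Mu c a b - SP.gen2 Mu Mu a b c"

definition deriv_rel :: "'l::{linorder,infinite} \<Rightarrow> 'l \<Rightarrow> 'l \<Rightarrow> ('l, 'k::field_char_0, sp_gen \<Rightarrow> 'k) tree_sum" where
  "deriv_rel a b c = SP.gen2 Seg Mu a b c - SP.gen2 Mu Seg c a b - SP.gen2 Mu Seg b a c"

definition dual_mixed_rel ::
  "'l::{linorder,infinite} \<Rightarrow> 'l \<Rightarrow> 'l \<Rightarrow> ('l, 'k::field_char_0, (sp_gen \<Rightarrow> 'k) \<Rightarrow> 'k) tree_sum" where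
  "dual_mixed_rel a b c = SPd.gen2 Mu Seg a b c + SPd.gen2 Seg Mu c a b + SPd.gen2 Seg Mu b c a"

definition dual_jacobi_rel ::
  "'l::{linorder,infinite} \<Rightarrow> 'l \<Rightarrow> 'l \<Rightarrow> ('l, 'k::field_char_0, (sp_gen \<Rightarrow> 'k) \<Rightarrow> 'k) tree_sum" where
  "dual_jacobi_rel a b c = SPd.gen2 Mu Mu a b c + SPd.gen2 Mu Mu c a b + SPd.gen2 Mu Mu b c a"

lemma permuted_triples:
  "{a, c, b} = {a, b, c}" "{b, a, c} = {a, b, c}" "{b, c, a} = {a, b, c}" "{c, a, b} = {a, b, c}"
  "{c, b, a} = {a, b, c}"
  by auto

lemma SP_relations_eq:
  assumes "distinct [a, b, c]"
  shows "SP_relations a b c = subspecies_gen (free_operad SP_species) (\<lambda>V. if V \<noteq> {a, b, c} then {} else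
    {cls SP_species {a, b, c} (assoc_rel a b c), cls SP_species {a, b, c} (deriv_rel a b c)})"
proof -
  have d: "distinct [c, a, b]" "distinct [b, a, c]"
    using assms by auto
  show ?thesis
    unfolding SP_relations_def Let_def SP.nested_eq[OF assms] SP.nested_eq[OF d(1)] SP.nested_eq[OF d(2)]
      permuted_triples[where a = a and b = b and c = c] free_vsub[OF SP.vector_species_axioms, of "{a, b, c}", simplified]
      assoc_rel_def deriv_rel_def ..
qed

lemma SP_dual_relations_eq:
  assumes "distinct [a, b, c]"
  shows "SP_dual_relations a b c = subspecies_gen (free_operad SP_dual) (\<lambda>V. if V \<noteq> {a, b, c} then {} else
    {cls SP_dual {a, b, c} (SPd.gen2 Seg Seg a b c), cls SP_dual {a, b, c} (dual_mixed_rel a b c),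
     cls SP_dual {a, b, c} (dual_jacobi_rel a b c)})"
proof -
  have d: "distinct [c, a, b]" "distinct [b, c, a]"
    using assms by auto
  show ?thesis
    unfolding SP_dual_relations_def Let_def SPd.nested_eq[OF assms] SPd.nested_eq[OF d(1)] SPd.nested_eq[OF d(2)]
      permuted_triples[where a = a and b = b and c = c] SPd.free_add[of "{a, b, c}", simplified] dual_mixed_rel_def dual_jacobi_rel_def ..
qed

lemmas coord2_gens = SP.coord2_simps SPd.coord2_simps SP.coord2_gen2 SPd.coord2_gen2

context
  fixes a b c :: "'l::{linorder,infinite}"
  assumes d: "distinct [a, b, c]"
begin

lemma rotations_distinct: "distinct [b, c, a]" "distinct [c, a, b]" "distinct [b, a, c]"
  using d by auto

lemma relations_two_nodes:
  "assoc_rel a b c \<in> two_nodes SP_species {a, b, c}" "deriv_rel a b c \<in> two_nodes SP_species {a, b, c}"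
  "SPd.gen2 Seg Seg a b c \<in> two_nodes SP_dual {a, b, c}"
  "dual_mixed_rel a b c \<in> two_nodes SP_dual {a, b, c}" "dual_jacobi_rel a b c \<in> two_nodes SP_dual {a, b, c}"
  using d rotations_distinct unfolding assoc_rel_def deriv_rel_def dual_mixed_rel_def dual_jacobi_rel_def
  by (intro two_nodes_diff two_nodes_add SP.gen2_two_nodes SPd.gen2_two_nodes; simp add: permuted_triples[where a = a and b = b and c = c])+

lemma coord2_assoc_rel:
  assumes "distinct [x, y, z]" "{x, y, z} = {a, b, c}"
  shows "SP.coord2 p q x y z (assoc_rel a b c) =
    (if p = Mu \<and> q = Mu then (if x = c then 1 else 0) - (if x = a then 1 else 0) else 0)"
  using assms d rotations_distinct
  by (simp add: coord2_gens assoc_rel_def permuted_triples[where a = a and b = b and c = c])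

lemma coord2_deriv_rel:
  assumes "distinct [x, y, z]" "{x, y, z} = {a, b, c}"
  shows "SP.coord2 p q x y z (deriv_rel a b c) =
    (if p = Seg \<and> q = Mu \<and> x = a then 1 else 0) - (if p = Mu \<and> q = Seg \<and> x \<noteq> a then 1 else 0)"
proof -
  have "x \<in> {a, b, c}"
    using assms by blast
  then show ?thesis
    using assms d rotations_distinct
    by (auto simp: coord2_gens deriv_rel_def permuted_triples[where a = a and b = b and c = c])
qed

end

section \<open>Equations bounding the relations of SP\<close>

text \<open>Up to a sign, the vanishing of the pairing of \<open>Q\<close> with the three dual
  relations at \<open>(x, y, z)\<close>.\<close>

definition satisfies_dual_rels ::
  "'l::{linorder,infinite} \<Rightarrow> 'l \<Rightarrow> 'l \<Rightarrow> ('l, 'k::field_char_0, sp_gen \<Rightarrow> 'k) tree_sum \<Rightarrow> bool" where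
  "satisfies_dual_rels x y z Q \<longleftrightarrow> SP.coord2 Seg Seg x y z Q = 0 \<and>
     SP.coord2 Mu Seg x y z Q + SP.coord2 Seg Mu y z x Q + SP.coord2 Seg Mu z x y Q = 0 \<and>
     SP.coord2 Mu Mu x y z Q + SP.coord2 Mu Mu y z x Q + SP.coord2 Mu Mu z x y Q = 0"

text \<open>The annihilator of the dual relations. All orders of the labels are imposed, for
  stability under relabelling; on a set without exactly three elements the condition is vacuous and
  the whole carrier results.\<close>

definition orthogonal_space ::
  "'l::{linorder,infinite} set \<Rightarrow> ('l, 'k::field_char_0, sp_gen \<Rightarrow> 'k) free_elt set" where
  "orthogonal_space V = cls SP_species V ` {Q \<in> fcarr SP_species V.
     \<forall>x y z. distinct [x, y, z] \<and> {x, y, z} = V \<longrightarrow> satisfies_dual_rels x y z Q}"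

lemma subspecies_orthogonal_space:
  "subspecies (free_operad (SP_species :: ('l::{linorder,infinite}, 'k::field_char_0, sp_gen \<Rightarrow> 'k) species))
    orthogonal_space"
  unfolding subspecies_def is_subspace_def
proof (intro conjI allI impI ballI image_subsetI)
  let ?G = "SP_species :: ('l, 'k, sp_gen \<Rightarrow> 'k) species"
  fix V :: "'l set" assume fin: "finite V"
  show "(orthogonal_space V :: ('l, 'k, sp_gen \<Rightarrow> 'k) free_elt set) \<subseteq> carr (obj (free_operad ?G) V)"
    using fin by (auto simp: orthogonal_space_def SP.free_carr)
  show "vzero (obj (free_operad ?G) V) \<in> orthogonal_space V"
    using fin by (auto simp: orthogonal_space_def SP.free_zero satisfies_dual_rels_def SP.coord2_simps)
  fix f g :: "('l, 'k, sp_gen \<Rightarrow> 'k) free_elt" and k :: 'k assume "f \<in> orthogonal_space V"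
  then obtain P where P: "f = cls ?G V P" "P \<in> fcarr ?G V"
    "\<And>x y z. distinct [x, y, z] \<Longrightarrow> {x, y, z} = V \<Longrightarrow> satisfies_dual_rels x y z P"
    unfolding orthogonal_space_def by blast
  have "satisfies_dual_rels x y z (scl k P)" if "distinct [x, y, z]" "{x, y, z} = V" for x y z
    using P(3)[OF that] by (simp add: satisfies_dual_rels_def SP.coord2_simps flip: distrib_left)
  then show "vscale (obj (free_operad ?G) V) k f \<in> orthogonal_space V"
    using fin P unfolding orthogonal_space_def
    by (auto simp: SP.free_scale fcarr_scl intro!: image_eqI[OF refl])
  assume "g \<in> orthogonal_space V"
  then obtain Q where Q: "g = cls ?G V Q" "Q \<in> fcarr ?G V"
    "\<And>x y z. distinct [x, y, z] \<Longrightarrow> {x, y, z} = V \<Longrightarrow> satisfies_dual_rels x y z Q"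
    unfolding orthogonal_space_def by blast
  have "satisfies_dual_rels x y z (P + Q)" if "distinct [x, y, z]" "{x, y, z} = V" for x y z
  proof -
    have *: "(r + r') + (s + s') + (t + t') = (r + s + t) + (r' + s' + t')" for r s t r' s' t' :: 'k
      by simp
    then show ?thesis
      using P(3)[OF that] Q(3)[OF that] unfolding satisfies_dual_rels_def SP.coord2_simps * by simp
  qed
  then show "vadd (obj (free_operad ?G) V) f g \<in> orthogonal_space V"
    using fin P Q unfolding orthogonal_space_def
    by (auto simp: SP.free_add fcarr_add intro!: image_eqI[OF refl])
next
  let ?G = "SP_species :: ('l, 'k, sp_gen \<Rightarrow> 'k) species"
  fix V :: "'l set" and \<sigma> :: "'l \<Rightarrow> 'l" and f :: "('l, 'k, sp_gen \<Rightarrow> 'k) free_elt" assume \<sigma>: "finite V \<and> inj_on \<sigma> V" and "f \<in> orthogonal_space V"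
  then obtain P where P: "f = cls ?G V P" "P \<in> fcarr ?G V"
    "\<And>x y z. distinct [x, y, z] \<Longrightarrow> {x, y, z} = V \<Longrightarrow> satisfies_dual_rels x y z P"
    unfolding orthogonal_space_def by blast
  have "satisfies_dual_rels x' y' z' (factn ?G V \<sigma> P)" if xyz: "distinct [x', y', z']" "{x', y', z'} = \<sigma> ` V" for x' y' z' :: 'l
  proof -
    have "x' \<in> \<sigma> ` V" "y' \<in> \<sigma> ` V" "z' \<in> \<sigma> ` V"
      using xyz by auto
    then obtain x y z where e: "x' = \<sigma> x" "y' = \<sigma> y" "z' = \<sigma> z" "x \<in> V" "y \<in> V" "z \<in> V"
      by blast
    have "\<sigma> ` {x, y, z} = \<sigma> ` V"
      using xyz e by simp
    then have V: "{x, y, z} = V"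
      using \<sigma> e inj_on_image_eq_iff[of \<sigma> V "{x, y, z}" V] by auto
    have *: "SP.coord2 p q (\<sigma> r) (\<sigma> s) (\<sigma> t) (factn ?G V \<sigma> P) = SP.coord2 p q r s t P"
      if "{r, s, t} \<subseteq> V" for p q r s t
      using SP.coord2_factn[OF _ that P(2)] \<sigma> by blast
    have "distinct [x, y, z]"
      using xyz e by auto
    then show ?thesis
      using P(3)[OF _ V] e unfolding satisfies_dual_rels_def by (simp add: *)
  qed
  then show "act (free_operad ?G) V \<sigma> f \<in> orthogonal_space (\<sigma> ` V)"
    using \<sigma> P unfolding orthogonal_space_def
    by (auto simp: SP.free_act factn_fcarr intro!: image_eqI[OF refl])
qed

text \<open>In each equation the coefficients of a relation are either all 0 or one +1 and one
  -1.\<close>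

lemma relations_in_orthogonal_space:
  assumes d: "distinct [a, b, c]"
  shows "cls SP_species {a, b, c} (assoc_rel a b c) \<in> orthogonal_space {a, b, c}"
    "cls SP_species {a, b, c} (deriv_rel a b c) \<in> orthogonal_space {a, b, c}"
proof -
  have ne: "a \<noteq> b" "b \<noteq> a" "a \<noteq> c" "c \<noteq> a" "b \<noteq> c" "c \<noteq> b"
    using d by auto
  have "satisfies_dual_rels x y z (assoc_rel a b c) \<and> satisfies_dual_rels x y z (deriv_rel a b c)"
    if xyz: "distinct [x, y, z]" "{x, y, z} = {a, b, c}" for x y z
  proof -
    have mem: "x \<in> {a, b, c}" "y \<in> {a, b, c}" "z \<in> {a, b, c}"
      using xyz(2) by blast+
    consider "x = a" "y = b" "z = c" | "x = a" "y = c" "z = b" | "x = b" "y = c" "z = a" |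
      "x = b" "y = a" "z = c" | "x = c" "y = a" "z = b" | "x = c" "y = b" "z = a"
      using mem xyz(1) by (elim insertE emptyE) simp_all
    then show ?thesis
      by cases (simp_all add: satisfies_dual_rels_def coord2_assoc_rel[OF d] coord2_deriv_rel[OF d] ne
        permuted_triples[where a = a and b = b and c = c])
  qed
  then show "cls SP_species {a, b, c} (assoc_rel a b c) \<in> orthogonal_space {a, b, c}"
    "cls SP_species {a, b, c} (deriv_rel a b c) \<in> orthogonal_space {a, b, c}"
    using relations_two_nodes[OF d] unfolding orthogonal_space_def
    by (auto intro!: image_eqI[OF refl] two_nodes_fcarr)
qed

text \<open>\<open>orthogonal_space\<close> serves as the witness that some sub-species contains the
  generating relations.\<close>

lemma subspecies_SP_relations:
  fixes a b c :: "'l::{linorder,infinite}"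
  assumes d: "distinct [a, b, c]"
  shows "subspecies (free_operad SP_species) (SP_relations a b c)"
  unfolding SP_relations_eq[OF d]
  by (rule subspecies_subspecies_gen[OF subspecies_orthogonal_space])
    (simp add: relations_in_orthogonal_space[OF d])

lemma SP_relations_orthogonal_space:
  fixes a b c :: "'l::{linorder,infinite}"
  assumes d: "distinct [a, b, c]"
  shows "SP_relations a b c V \<subseteq> orthogonal_space V"
  unfolding SP_relations_eq[OF d]
  by (rule subspecies_gen_least[OF subspecies_orthogonal_space])
    (simp add: relations_in_orthogonal_space[OF d])

lemma SP_relations_gens:
  fixes a b c :: "'l::{linorder,infinite}"
  assumes d: "distinct [a, b, c]"
  shows "cls SP_species {a, b, c} (assoc_rel a b c) \<in> SP_relations a b c {a, b, c}"
    "cls SP_species {a, b, c} (deriv_rel a b c) \<in> SP_relations a b c {a, b, c}"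
  unfolding SP_relations_eq[OF d]
  by (rule subsetD[OF subspecies_gen_contains]; simp)+

section \<open>The dual relations are orthogonal\<close>

lemma dual_rels_pairing:
  fixes a b c :: "'l::{linorder,infinite}"
  assumes d: "distinct [a, b, c]" and Q: "satisfies_dual_rels a b c Q" "satisfies_dual_rels b c a Q" "satisfies_dual_rels c a b Q"
  shows "sum_pairing a b c (SPd.gen2 Seg Seg a b c) Q = 0" "sum_pairing a b c (dual_mixed_rel a b c) Q = 0"
    "sum_pairing a b c (dual_jacobi_rel a b c) Q = 0"
proof -
  have ne: "a \<noteq> b" "b \<noteq> a" "a \<noteq> c" "c \<noteq> a" "b \<noteq> c" "c \<noteq> b"
    using d by auto
  show "sum_pairing a b c (SPd.gen2 Seg Seg a b c) Q = 0" "sum_pairing a b c (dual_mixed_rel a b c) Q = 0"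
    "sum_pairing a b c (dual_jacobi_rel a b c) Q = 0"
    using Q(1) by (simp_all add: sum_pairing_def pair_row_def dual_mixed_rel_def dual_jacobi_rel_def coord2_gens ne
        permuted_triples[where a = a and b = b and c = c] satisfies_dual_rels_def)
qed

text \<open>Instead of running through the generated sub-species, it is enough to use the equations
  that all its elements satisfy.\<close>

lemma orthogonalI:
  fixes D :: "('l::{linorder,infinite}, 'k::field_char_0, (sp_gen \<Rightarrow> 'k) \<Rightarrow> 'k) tree_sum"
  assumes d: "distinct [a, b, c]" and D: "D \<in> two_nodes SP_dual {a, b, c}"
    and zero: "\<And>Q. satisfies_dual_rels a b c Q \<Longrightarrow> satisfies_dual_rels b c a Q \<Longrightarrow>
        satisfies_dual_rels c a b Q \<Longrightarrow> sum_pairing a b c D Q = 0"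
  shows "cls SP_dual {a, b, c} D \<in> orthogonal SP_species (SP_relations a b c) {a, b, c}"
  unfolding orthogonal_def
proof (intro CollectI conjI ballI)
  show "cls SP_dual {a, b, c} D \<in> carr (free_two SP_dual {a, b, c})"
    using D by (simp add: carr_free_two)
  fix r :: "('l, 'k, sp_gen \<Rightarrow> 'k) free_elt" assume "r \<in> SP_relations a b c {a, b, c}"
  then have "r \<in> orthogonal_space {a, b, c}"
    using SP_relations_orthogonal_space[OF d] by blast
  then obtain Q where Q: "r = cls SP_species {a, b, c} Q" and
    *: "\<And>x y z. distinct [x, y, z] \<and> {x, y, z} = {a, b, c} \<Longrightarrow> satisfies_dual_rels x y z Q"
    unfolding orthogonal_space_def by blast
  have "sum_pairing a b c D Q = 0"
    using d by (intro zero *) auto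
  moreover have "sum_pairing a b c (rep (cls SP_dual {a, b, c} D)) (rep r) = sum_pairing a b c D Q"
    unfolding Q by (intro sum_pairing_tree_ideal[of _ _ "{a, b, c}"] SPd.rep_cls SP.rep_cls) auto
  \<comment> \<open>Nothing has been shown about \<open>r\<close> lying in the two-node part.
    Outside it \<open>SP_form\<close> is 0 by convention, so both branches give 0.\<close>
  ultimately show "natural_pairing SP_species {a, b, c} (cls SP_dual {a, b, c} D) r = 0"
    by (simp add: natural_pairing_eq[OF d] SP_form_def)
qed

lemma dual_rels_orthogonal:
  fixes a b c :: "'l::{linorder,infinite}"
  assumes d: "distinct [a, b, c]"
  shows "cls SP_dual {a, b, c} (SPd.gen2 Seg Seg a b c) \<in> orthogonal SP_species (SP_relations a b c) {a, b, c}"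
    "cls SP_dual {a, b, c} (dual_mixed_rel a b c) \<in> orthogonal SP_species (SP_relations a b c) {a, b, c}"
    "cls SP_dual {a, b, c} (dual_jacobi_rel a b c) \<in> orthogonal SP_species (SP_relations a b c) {a, b, c}"
  by (intro orthogonalI[OF d] relations_two_nodes[OF d] dual_rels_pairing[OF d]; assumption)+

section \<open>Orthogonal elements are combinations of dual relations\<close>

lemma dual_rels_transport:
  fixes I :: "'l set \<Rightarrow> ('l::{linorder,infinite}, 'k::field_char_0, (sp_gen \<Rightarrow> 'k) \<Rightarrow> 'k) free_elt set"
  assumes d: "distinct [a, b, c]" and I: "subspecies (free_operad SP_dual) I"
    "cls SP_dual {a, b, c} (SPd.gen2 Seg Seg a b c) \<in> I {a, b, c}"
    "cls SP_dual {a, b, c} (dual_mixed_rel a b c) \<in> I {a, b, c}"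
    "cls SP_dual {a, b, c} (dual_jacobi_rel a b c) \<in> I {a, b, c}"
    and V: "distinct [x, y, z]" "{x, y, z} = V"
  obtains D1 D2 D3 where "D1 \<in> two_nodes SP_dual V" "D2 \<in> two_nodes SP_dual V" "D3 \<in> two_nodes SP_dual V"
    "cls SP_dual V D1 \<in> I V" "cls SP_dual V D2 \<in> I V" "cls SP_dual V D3 \<in> I V"
    "\<forall>p q. SPd.coord2 p q x y z D1 = (if p = Seg \<and> q = Seg then 1 else 0)"
    "\<forall>p q. SPd.coord2 p q y z x D1 = 0" "\<forall>p q. SPd.coord2 p q z x y D1 = 0"
    "\<forall>p q. SPd.coord2 p q x y z D2 = (if p = Mu \<and> q = Seg then 1 else 0)"
    "\<forall>p q. SPd.coord2 p q y z x D2 = (if p = Seg \<and> q = Mu then 1 else 0)"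
    "\<forall>p q. SPd.coord2 p q z x y D2 = (if p = Seg \<and> q = Mu then 1 else 0)"
    "\<forall>p q. SPd.coord2 p q x y z D3 = (if p = Mu \<and> q = Mu then 1 else 0)"
    "\<forall>p q. SPd.coord2 p q y z x D3 = (if p = Mu \<and> q = Mu then 1 else 0)"
    "\<forall>p q. SPd.coord2 p q z x y D3 = (if p = Mu \<and> q = Mu then 1 else 0)"
proof -
  have ne: "a \<noteq> b" "b \<noteq> a" "a \<noteq> c" "c \<noteq> a" "b \<noteq> c" "c \<noteq> b"
    using d by auto
  note perm = permuted_triples[where a = a and b = b and c = c]
  obtain D1 where D1: "D1 \<in> two_nodes SP_dual V" "cls SP_dual V D1 \<in> I V"
    "\<And>p q. SPd.coord2 p q x y z D1 = SPd.coord2 p q a b c (SPd.gen2 Seg Seg a b c)"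
    "\<And>p q. SPd.coord2 p q y z x D1 = SPd.coord2 p q b c a (SPd.gen2 Seg Seg a b c)"
    "\<And>p q. SPd.coord2 p q z x y D1 = SPd.coord2 p q c a b (SPd.gen2 Seg Seg a b c)"
    using SPd.coord2_transport[OF I(1) relations_two_nodes(3)[OF d] I(2) d V] by blast
  obtain D2 where D2: "D2 \<in> two_nodes SP_dual V" "cls SP_dual V D2 \<in> I V"
    "\<And>p q. SPd.coord2 p q x y z D2 = SPd.coord2 p q a b c (dual_mixed_rel a b c)"
    "\<And>p q. SPd.coord2 p q y z x D2 = SPd.coord2 p q b c a (dual_mixed_rel a b c)"
    "\<And>p q. SPd.coord2 p q z x y D2 = SPd.coord2 p q c a b (dual_mixed_rel a b c)"
    using SPd.coord2_transport[OF I(1) relations_two_nodes(4)[OF d] I(3) d V] by blast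
  obtain D3 where D3: "D3 \<in> two_nodes SP_dual V" "cls SP_dual V D3 \<in> I V"
    "\<And>p q. SPd.coord2 p q x y z D3 = SPd.coord2 p q a b c (dual_jacobi_rel a b c)"
    "\<And>p q. SPd.coord2 p q y z x D3 = SPd.coord2 p q b c a (dual_jacobi_rel a b c)"
    "\<And>p q. SPd.coord2 p q z x y D3 = SPd.coord2 p q c a b (dual_jacobi_rel a b c)"
    using SPd.coord2_transport[OF I(1) relations_two_nodes(5)[OF d] I(4) d V] by blast
  show ?thesis
    by (rule that[OF D1(1) D2(1) D3(1) D1(2) D2(2) D3(2)])
      (simp_all add: D1 D2 D3 ne perm coord2_gens dual_mixed_rel_def dual_jacobi_rel_def conj_commute eq_commute[of Mu] eq_commute[of Seg])
qed

text \<open>Pairing with the relabelled associativity relation equates two coordinates of type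
  (\<open>Mu\<close>, \<open>Mu\<close>); pairing with the derivation relation expresses
  (\<open>Seg\<close>, \<open>Mu\<close>) through (\<open>Mu\<close>, \<open>Seg\<close>). Over the
  rotations this leaves 3 + 3 + 1 free coordinates.\<close>

lemma orthogonal_coordinates:
  fixes P :: "('l::{linorder,infinite}, 'k::field_char_0, (sp_gen \<Rightarrow> 'k) \<Rightarrow> 'k) tree_sum"
  assumes d: "distinct [a, b, c]" and V: "distinct [x, y, z]" "{x, y, z} = V"
    and P: "P \<in> two_nodes SP_dual V" "cls SP_dual V P \<in> orthogonal SP_species (SP_relations a b c) V"
  shows "SPd.coord2 Mu Mu x y z P = SPd.coord2 Mu Mu z x y P"
    and "SPd.coord2 Seg Mu x y z P = SPd.coord2 Mu Seg y z x P + SPd.coord2 Mu Seg z x y P"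
proof -
  have pair: "sum_pairing x y z P Q = 0" if "Q \<in> two_nodes SP_species V" "cls SP_species V Q \<in> SP_relations a b c V"
    for Q :: "('l, 'k, sp_gen \<Rightarrow> 'k) tree_sum"
    using P that V by (auto simp: orthogonal_def natural_pairing_eq[OF V(1)] SP_form_cls)
  have rot: "distinct [b, c, a]" "{b, c, a} = {a, b, c}" "distinct [c, a, b]" "{c, a, b} = {a, b, c}"
    using d by auto
  have ne: "a \<noteq> b" "b \<noteq> a" "a \<noteq> c" "c \<noteq> a" "b \<noteq> c" "c \<noteq> b"
    using d by auto
  note co = coord2_assoc_rel[OF d d refl] coord2_assoc_rel[OF d rot(1,2)] coord2_assoc_rel[OF d rot(3,4)]
    coord2_deriv_rel[OF d d refl] coord2_deriv_rel[OF d rot(1,2)] coord2_deriv_rel[OF d rot(3,4)]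
  obtain Q :: "('l, 'k, sp_gen \<Rightarrow> 'k) tree_sum" where Q: "Q \<in> two_nodes SP_species V" "cls SP_species V Q \<in> SP_relations a b c V"
    "\<And>p q. SP.coord2 p q x y z Q = SP.coord2 p q a b c (assoc_rel a b c)"
    "\<And>p q. SP.coord2 p q y z x Q = SP.coord2 p q b c a (assoc_rel a b c)"
    "\<And>p q. SP.coord2 p q z x y Q = SP.coord2 p q c a b (assoc_rel a b c)"
    using SP.coord2_transport[OF subspecies_SP_relations[OF d] relations_two_nodes(1)[OF d]
        SP_relations_gens(1)[OF d] d V] by blast
  have nz: "seq_sign [x, y, z] \<noteq> (0 :: 'k)"
    by (simp add: seq_sign_def)
  show "SPd.coord2 Mu Mu x y z P = SPd.coord2 Mu Mu z x y P"
    using pair[OF Q(1,2)] nz by (simp add: sum_pairing_def pair_row_def Q(3-5) co ne)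
  obtain Q :: "('l, 'k, sp_gen \<Rightarrow> 'k) tree_sum" where Q: "Q \<in> two_nodes SP_species V" "cls SP_species V Q \<in> SP_relations a b c V"
    "\<And>p q. SP.coord2 p q x y z Q = SP.coord2 p q a b c (deriv_rel a b c)"
    "\<And>p q. SP.coord2 p q y z x Q = SP.coord2 p q b c a (deriv_rel a b c)"
    "\<And>p q. SP.coord2 p q z x y Q = SP.coord2 p q c a b (deriv_rel a b c)"
    using SP.coord2_transport[OF subspecies_SP_relations[OF d] relations_two_nodes(2)[OF d]
        SP_relations_gens(2)[OF d] d V] by blast
  show "SPd.coord2 Seg Mu x y z P = SPd.coord2 Mu Seg y z x P + SPd.coord2 Mu Seg z x y P"
    using pair[OF Q(1,2)] nz by (simp add: sum_pairing_def pair_row_def Q(3-5) co ne) (simp add: algebra_simps)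
qed

lemma orthogonal_subset:
  fixes I :: "'l set \<Rightarrow> ('l::{linorder,infinite}, 'k::field_char_0, (sp_gen \<Rightarrow> 'k) \<Rightarrow> 'k) free_elt set"
  assumes d: "distinct [a, b, c]" and I: "subspecies (free_operad SP_dual) I"
    "cls SP_dual {a, b, c} (SPd.gen2 Seg Seg a b c) \<in> I {a, b, c}"
    "cls SP_dual {a, b, c} (dual_mixed_rel a b c) \<in> I {a, b, c}"
    "cls SP_dual {a, b, c} (dual_jacobi_rel a b c) \<in> I {a, b, c}"
    and fin: "finite V"
  shows "orthogonal SP_species (SP_relations a b c) V \<subseteq> I V"
proof
  fix f :: "('l, 'k, (sp_gen \<Rightarrow> 'k) \<Rightarrow> 'k) free_elt" assume f: "f \<in> orthogonal SP_species (SP_relations a b c) V"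
  then obtain P where P: "P \<in> two_nodes SP_dual V" "f = cls SP_dual V P"
    by (auto simp: orthogonal_def carr_free_two)
  note sub = subspecies_subspace[OF I(1) fin]
  show "f \<in> I V"
  proof (cases "card V = 3")
    case False
    then show ?thesis
      using P subspaceD(2)[OF sub] fin by (simp add: two_nodes_trivial SPd.free_zero)
  next
    case True
    then obtain u v w where V: "V = {u, v, w}" "distinct [u, v, w]"
      by (auto simp: card_3_iff)
    have V': "distinct [v, w, u]" "{v, w, u} = V" "distinct [w, u, v]" "{w, u, v} = V"
      using V by auto
    obtain A1 A2 A3 where A: "A1 \<in> two_nodes SP_dual V" "A2 \<in> two_nodes SP_dual V" "A3 \<in> two_nodes SP_dual V"
      "cls SP_dual V A1 \<in> I V" "cls SP_dual V A2 \<in> I V" "cls SP_dual V A3 \<in> I V"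
      "\<forall>p q. SPd.coord2 p q u v w A1 = (if p = Seg \<and> q = Seg then 1 else 0)"
      "\<forall>p q. SPd.coord2 p q v w u A1 = 0" "\<forall>p q. SPd.coord2 p q w u v A1 = 0"
      "\<forall>p q. SPd.coord2 p q u v w A2 = (if p = Mu \<and> q = Seg then 1 else 0)"
      "\<forall>p q. SPd.coord2 p q v w u A2 = (if p = Seg \<and> q = Mu then 1 else 0)"
      "\<forall>p q. SPd.coord2 p q w u v A2 = (if p = Seg \<and> q = Mu then 1 else 0)"
      "\<forall>p q. SPd.coord2 p q u v w A3 = (if p = Mu \<and> q = Mu then 1 else 0)"
      "\<forall>p q. SPd.coord2 p q v w u A3 = (if p = Mu \<and> q = Mu then 1 else 0)"
      "\<forall>p q. SPd.coord2 p q w u v A3 = (if p = Mu \<and> q = Mu then 1 else 0)"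
      by (rule dual_rels_transport[OF d I V(2) V(1)[symmetric]])
    obtain B1 B2 B3 where B: "B1 \<in> two_nodes SP_dual V" "B2 \<in> two_nodes SP_dual V" "B3 \<in> two_nodes SP_dual V"
      "cls SP_dual V B1 \<in> I V" "cls SP_dual V B2 \<in> I V" "cls SP_dual V B3 \<in> I V"
      "\<forall>p q. SPd.coord2 p q v w u B1 = (if p = Seg \<and> q = Seg then 1 else 0)"
      "\<forall>p q. SPd.coord2 p q w u v B1 = 0" "\<forall>p q. SPd.coord2 p q u v w B1 = 0"
      "\<forall>p q. SPd.coord2 p q v w u B2 = (if p = Mu \<and> q = Seg then 1 else 0)"
      "\<forall>p q. SPd.coord2 p q w u v B2 = (if p = Seg \<and> q = Mu then 1 else 0)"
      "\<forall>p q. SPd.coord2 p q u v w B2 = (if p = Seg \<and> q = Mu then 1 else 0)"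
      by (rule dual_rels_transport[OF d I V'(1,2)])
    obtain C1 C2 C3 where C: "C1 \<in> two_nodes SP_dual V" "C2 \<in> two_nodes SP_dual V" "C3 \<in> two_nodes SP_dual V"
      "cls SP_dual V C1 \<in> I V" "cls SP_dual V C2 \<in> I V" "cls SP_dual V C3 \<in> I V"
      "\<forall>p q. SPd.coord2 p q w u v C1 = (if p = Seg \<and> q = Seg then 1 else 0)"
      "\<forall>p q. SPd.coord2 p q u v w C1 = 0" "\<forall>p q. SPd.coord2 p q v w u C1 = 0"
      "\<forall>p q. SPd.coord2 p q w u v C2 = (if p = Mu \<and> q = Seg then 1 else 0)"
      "\<forall>p q. SPd.coord2 p q u v w C2 = (if p = Seg \<and> q = Mu then 1 else 0)"
      "\<forall>p q. SPd.coord2 p q v w u C2 = (if p = Seg \<and> q = Mu then 1 else 0)"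
      by (rule dual_rels_transport[OF d I V'(3,4)])
    \<comment> \<open>The coefficients are the free coordinates of \<open>P\<close>. The others
      agree by \<open>orthogonal_coordinates\<close>: the (\<open>Seg\<close>, \<open>Mu\<close>)
      coordinate at \<open>(u, v, w)\<close> is supplied by \<open>B2\<close> and \<open>C2\<close>,
      and \<open>A3\<close> supplies the common (\<open>Mu\<close>, \<open>Mu\<close>) coordinate of
      all rotations.\<close>
    define Q where "Q = scl (SPd.coord2 Seg Seg u v w P) A1 + scl (SPd.coord2 Seg Seg v w u P) B1 +
      scl (SPd.coord2 Seg Seg w u v P) C1 + scl (SPd.coord2 Mu Seg u v w P) A2 +
      scl (SPd.coord2 Mu Seg v w u P) B2 + scl (SPd.coord2 Mu Seg w u v P) C2 + scl (SPd.coord2 Mu Mu u v w P) A3"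
    have add: "cls SP_dual V (S + T) \<in> I V" if "cls SP_dual V S \<in> I V" "cls SP_dual V T \<in> I V" for S T
      using subspaceD(3)[OF sub that] by (simp add: SPd.free_add[OF fin])
    have scale: "cls SP_dual V (scl k S) \<in> I V" if "cls SP_dual V S \<in> I V" for S k
      using subspaceD(4)[OF sub that] by (simp add: SPd.free_scale[OF fin])
    have Q: "cls SP_dual V Q \<in> I V" "Q \<in> two_nodes SP_dual V"
      unfolding Q_def by (intro add scale two_nodes_add two_nodes_scl A B C)+
    have f': "cls SP_dual V P \<in> orthogonal SP_species (SP_relations a b c) V"
      using f P by simp
    note o = orthogonal_coordinates[OF d V(2) V(1)[symmetric] P(1) f'] orthogonal_coordinates[OF d V'(1,2) P(1) f']
      orthogonal_coordinates[OF d V'(3,4) P(1) f']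
    have "cls SP_dual V P = cls SP_dual V Q"
      unfolding V(1)
    proof (rule SPd.two_nodes_coord2_eq[OF V(2)])
      fix p q x y z assume "(x, y, z) \<in> cyc u v w"
      then consider "x = u" "y = v" "z = w" | "x = v" "y = w" "z = u" | "x = w" "y = u" "z = v"
        by (auto simp: cyc_def)
      then show "SPd.coord2 p q x y z P = SPd.coord2 p q x y z Q"
        unfolding Q_def SPd.coord2_simps
        by cases (cases p; cases q; simp add: A B C o(2,3,4,6) o(1)[symmetric] add.commute)+
    qed (use P(1) Q(2) V(1) in auto)
    then show ?thesis
      using Q(1) P(2) by simp
  qed
qed

section \<open>Equality of the two ideals\<close>

lemma operad_isomorphic_refl: "operad_isomorphic P P"
  unfolding operad_isomorphic_def
  by (rule exI[of _ "\<lambda>_ x. x"]) (auto simp: operad_isomorphism_def linear_map_def bij_betw_def)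

text \<open>If the same ideals contain both families, the two intersections have the same members.
  So the values agree on every set, although containment is tested on finite sets.\<close>

lemma ideal_gen_eqI:
  assumes "\<And>I. operad_ideal P I \<Longrightarrow> (\<forall>U. finite U \<longrightarrow> X U \<subseteq> I U) \<longleftrightarrow> (\<forall>U. finite U \<longrightarrow> Y U \<subseteq> I U)"
  shows "ideal_gen P X = ideal_gen P Y"
  using assms by (auto simp: fun_eq_iff set_eq_iff ideal_gen_iff)

text \<open>Both operads are quotients of one free operad, so equal ideals give equal records. For
  an ideal, containing either family amounts to containing the three relations at
  \<open>{a, b, c}\<close>.\<close>

lemma koszul_dual_SP:
  fixes a b c :: "'l::{linorder,infinite}"
  assumes d: "distinct [a, b, c]"
  shows "koszul_dual (SP_species :: ('l, 'k::field_char_0, sp_gen \<Rightarrow> 'k) species) (SP_relations a b c) =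
    Ope SP_dual (SP_dual_relations a b c)"
proof -
  let ?D = "SP_dual :: ('l, 'k, (sp_gen \<Rightarrow> 'k) \<Rightarrow> 'k) species"
  define X where "X V = (if V \<noteq> {a, b, c} then {} else
    {cls ?D {a, b, c} (SPd.gen2 Seg Seg a b c), cls ?D {a, b, c} (dual_mixed_rel a b c),
     cls ?D {a, b, c} (dual_jacobi_rel a b c)})" for V
  have X: "SP_dual_relations a b c = subspecies_gen (free_operad ?D) X"
    unfolding SP_dual_relations_eq[OF d] X_def ..
  have "ideal_gen (free_operad ?D) (orthogonal SP_species (SP_relations a b c)) =
      ideal_gen (free_operad ?D) (SP_dual_relations a b c)"
  proof (rule ideal_gen_eqI)
    fix I :: "'l set \<Rightarrow> ('l, 'k, (sp_gen \<Rightarrow> 'k) \<Rightarrow> 'k) free_elt set"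
    assume I: "operad_ideal (free_operad ?D) I"
    note sub = operad_ideal_subspecies[OF I]
    have "SP_dual_relations a b c U \<subseteq> I U"
      if *: "\<forall>U. finite U \<longrightarrow> orthogonal SP_species (SP_relations a b c) U \<subseteq> I U" for U
    proof -
      have "orthogonal SP_species (SP_relations a b c) {a, b, c} \<subseteq> I {a, b, c}"
        using * by simp
      then have "X V \<subseteq> I V" for V
        using dual_rels_orthogonal[OF d] by (auto simp: X_def)
      then show ?thesis
        unfolding X by (rule subspecies_gen_least[OF sub])
    qed
    moreover have "orthogonal SP_species (SP_relations a b c) U \<subseteq> I U"
      if *: "\<forall>U. finite U \<longrightarrow> SP_dual_relations a b c U \<subseteq> I U" and U: "finite U" for U
    proof -
      have "X {a, b, c} \<subseteq> SP_dual_relations a b c {a, b, c}"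
        unfolding X by (rule subspecies_gen_contains) simp
      also have "\<dots> \<subseteq> I {a, b, c}"
        using * by simp
      finally have "X {a, b, c} \<subseteq> I {a, b, c}" .
      then show ?thesis
        by (intro orthogonal_subset[OF d sub _ _ _ U]) (simp_all add: X_def)
    qed
    ultimately show "(\<forall>U. finite U \<longrightarrow> orthogonal SP_species (SP_relations a b c) U \<subseteq> I U) \<longleftrightarrow>
        (\<forall>U. finite U \<longrightarrow> SP_dual_relations a b c U \<subseteq> I U)"
      by blast
  qed
  then show ?thesis
    by (simp add: koszul_dual_def Ope_def)
qed

theorem proposition2p12:
  fixes a b c :: "'l::{linorder, infinite}"
  assumes "distinct [a, b, c]"
  shows "has_two_antisymmetric_generators
      (dual_species SP_species :: ('l, 'k::field_char_0, (sp_gen \<Rightarrow> 'k) \<Rightarrow> 'k) species)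
      (SP_dual_gen Mu) (SP_dual_gen Seg)
    \<and> operad_isomorphic
      (koszul_dual (SP_species :: ('l, 'k, sp_gen \<Rightarrow> 'k) species) (SP_relations a b c))
      (Ope (dual_species SP_species) (SP_dual_relations a b c))"
  unfolding koszul_dual_SP[OF assms]
  by (intro conjI antisymmetric_generators operad_isomorphic_refl)

end
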